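(* For every $\lambda>0$ there exist universal constants $0<c(\lambda)$ and $C(\lambda)<\infty$, depending only on $\lambda$ (and the dimension $d$), such that for every point process $\Phi$ on $\mathbb{R}^d$ the following hold. (i) If $\Phi\le_{idcx}\Phi_\lambda$, then $c(\lambda)\le r_c(\Phi)$. (ii) If $\Phi\le_{ddcx}\Phi_\lambda$, then $r_c(\Phi)\le C(\lambda)$. (iii) Thus, if $\Phi$ is homogeneous of intensity $\lambda$ and $dcx$-sub-Poisson, then $0<c(\lambda)\le r_c(\Phi)\le C(\lambda)<\infty$, where the constants depend only on $\lambda$ (and $d$). (iv) The lower bound $c(\lambda)\le r_c(\Phi)$ holds also when $\Phi$ is weakly sub-Poisson (with constant $\lambda$).
   Context: A point process on $\mathbb{R}^d$ is a locally finite random counting measure on $\mathbb{R}^d$, also identified with the random collection of its points; $\Phi(B)$ is the number of points in $B$. $\Phi_\lambda$ denotes the homogeneous Poisson point process on $\mathbb{R}^d$ of intensity $\lambda$. $|B|$ denotes $d$-dimensional Lebesgue measure. Directionally convex functions: $f:\mathbb{R}^n\to\mathbb{R}$ is directionally convex ($dcx$) if for all $x,y,p,q\in\mathbb{R}^n$ with $p\le x\le q$, $p\le y\le q$ (componentwise) and $x+y=p+q$ one has $f(x)+f(y)\le f(p)+f(q)$. A function is $idcx$ (respectively $ddcx$) if it is $dcx$ and increasing (respectively decreasing). Orders: for real-valued random vectors $X,Y$ of the same dimension, $X\le_{dcx}Y$ (respectively $\le_{idcx}$, $\le_{ddcx}$) if $\mathbf{E}[f(X)]\le\mathbf{E}[f(Y)]$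 for every $dcx$ (respectively $idcx$, $ddcx$) function $f$ for which both expectations are finite. For point processes, $\Phi_1\le_{dcx}\Phi_2$ (respectively $\le_{idcx}$, $\le_{ddcx}$) if for all finitely many bounded Borel sets $B_1,\ldots,B_n$ the vectors $(\Phi_1(B_1),\ldots,\Phi_1(B_n))$ and $(\Phi_2(B_1),\ldots,\Phi_2(B_n))$ are ordered accordingly. Homogeneity and sub-Poisson: $\Phi$ is homogeneous of intensity $\lambda$ if $\mathbf{E}[\Phi(B)]=\lambda|B|$ for all bounded Borel sets $B$. $\Phi$ is $dcx$-sub-Poisson if $\Phi\le_{dcx}\Phi_{Poi}$ for some Poisson point process $\Phi_{Poi}$, which then necessarily has the same mean measure as $\Phi$; so for $\Phi$ homogeneous of intensity $\lambda$ this means $\Phi\le_{dcx}\Phi_\lambda$. Weakly sub-Poisson: the joint intensities $\rho^{(k)}$ of $\Phi$ are defined (when they exist) by $\mathbf{E}\bigl[\prod_{i=1}^k\Phi(B_i)\bigr]=\int_{B_1\times\cdots\times B_k}\rho^{(k)}(x_1,\ldots,x_k)\,dx_1\cdots dx_k$ for all disjoint bounded Borel sets $B_1,\ldots,B_k$. A point process $\Phi$ with joint intensities of all orders is weakly sub-Poisson if there exists a constant $\lambda$ (called here its constant) such that $\rho^{(k)}(x_1,\ldots,x_k)\le\lambda^k$ almost everywhere for all $k\ge1$. Boolean model and critical radius: for $r>0$, $C(\Phi,r)=\bigcup_{X\in\Phi}B_X(r)$, where $B_x(r)$ is the ball of radius $r$ centered at $x\in\mathbb{R}^d$. $C(\Phi,r)$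 percolates if there exists an unbounded, connected subset of $C(\Phi,r)$. The critical radius is $r_c(\Phi)=\inf\{r>0:\mathbf{P}\{C(\Phi,r)\text{ percolates}\}>0\}$ (with the usual convention $\inf\emptyset=\infty$).
   Formalization: Upper bounds in (ii), (iii) are stated for d ≥ 2 (for d = 1 the Poisson process has infinite critical radius); (i) also assumes that Φ has locally finite mean measure, since dense lattices with random multiplicity of infinite mean violate the lower bound. *)

theory Defs
  imports "HOL-Probability.Probability"
begin

section \<open>Point processes\<close>

definition bounded_borel :: "'a::euclidean_space set set" where
  "bounded_borel = {B \<in> sets borel. bounded B}"

definition configurations :: "'a::euclidean_space measure set" where
  "configurations = {\<mu>. sets \<mu> = sets borel \<and> (\<forall>B\<in>bounded_borel. emeasure \<mu> B \<in> \<nat>)}"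

definition configuration_space :: "'a::euclidean_space measure measure" where
  "configuration_space = sigma configurations
     {{\<mu> \<in> configurations. emeasure \<mu> B \<in> A} | B A. B \<in> bounded_borel \<and> A \<in> sets borel}"

text \<open>
  A point process is represented by its distribution, a probability measure on the space of
  configurations. All notions below depend on the distribution only, and a random element
  \<open>X\<close> of \<open>configuration_space\<close> on a probability space \<open>M\<close> is covered through
  \<open>distr M configuration_space X\<close>. Since the underlying type is then determined by
  the Euclidean space alone, constants chosen before a point process is fixed really are
  universal: they cannot depend on the sample space.
\<close>

definition point_process :: "'a::euclidean_space measure measure \<Rightarrow> bool" where
  "point_process \<Phi> \<longleftrightarrow> prob_space \<Phi> \<and> sets \<Phi> = sets configuration_space"

definition mean_measure :: "'a::euclidean_space measure measure \<Rightarrow> 'a set \<Rightarrow> ennreal" where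
  "mean_measure \<Phi> B = (\<integral>\<^sup>+ \<mu>. emeasure \<mu> B \<partial>\<Phi>)"

text \<open>
  The orders below only test functions for which both expectations are finite. If all mean counts
  of a process are infinite, the idcx order imposes essentially nothing: randomly shifted lattices
  of arbitrarily small spacing, all points having the same random multiplicity of infinite mean,
  lie below every Poisson process. Hence idcx comparison is used together with local finiteness
  of the mean measure.
\<close>

definition locally_finite_mean :: "'a::euclidean_space measure measure \<Rightarrow> bool" where
  "locally_finite_mean \<Phi> \<longleftrightarrow> (\<forall>B\<in>bounded_borel. mean_measure \<Phi> B < \<infinity>)"

definition homogeneous :: "real \<Rightarrow> 'a::euclidean_space measure measure \<Rightarrow> bool" where
  "homogeneous lam \<Phi> \<longleftrightarrow>
     (\<forall>B\<in>bounded_borel. mean_measure \<Phi> B = ennreal lam * emeasure lborel B)"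

text \<open>
  The probability mass function is written out because \<open>poisson_pmf\<close> is only specified for
  positive rates, whereas \<open>\<Lambda> B = 0\<close> has to be allowed.
\<close>

definition poisson_process ::
    "'a::euclidean_space measure \<Rightarrow> 'a measure measure \<Rightarrow> bool" where
  "poisson_process \<Lambda> \<Phi> \<longleftrightarrow>
     point_process \<Phi> \<and> sets \<Lambda> = sets borel \<and> (\<forall>B\<in>bounded_borel. emeasure \<Lambda> B < \<infinity>) \<and>
     (\<forall>B\<in>bounded_borel. \<forall>k::nat. measure \<Phi> {\<mu> \<in> space \<Phi>. emeasure \<mu> B = of_nat k} =
        measure \<Lambda> B ^ k / fact k * exp (- measure \<Lambda> B)) \<and>
     (\<forall>(n::nat) B. (\<forall>i<n. B i \<in> bounded_borel) \<and> disjoint_family_on B {..<n} \<longrightarrow>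
        prob_space.indep_vars \<Phi> (\<lambda>_. borel) (\<lambda>i \<mu>. measure \<mu> (B i)) {..<n})"

definition homogeneous_poisson_process ::
    "real \<Rightarrow> 'a::euclidean_space measure measure \<Rightarrow> bool" where
  "homogeneous_poisson_process lam \<Phi> \<longleftrightarrow> poisson_process (scale_measure (ennreal lam) lborel) \<Phi>"


section \<open>Directionally convex orders\<close>

text \<open>
  As the dimension varies inside the definition of the orders on point processes, vectors of
  dimension \<open>n\<close> are represented by extensional functions on \<open>{..<n}\<close>.
\<close>

definition vectors :: "nat \<Rightarrow> (nat \<Rightarrow> real) set" where
  "vectors n = ({..<n} \<rightarrow>\<^sub>E UNIV)"

definition dcx :: "nat \<Rightarrow> ((nat \<Rightarrow> real) \<Rightarrow> real) set" where
  "dcx n = {f. \<forall>x\<in>vectors n. \<forall>y\<in>vectors n. \<forall>p\<in>vectors n. \<forall>q\<in>vectors n.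
     (\<forall>i<n. p i \<le> x i \<and> x i \<le> q i \<and> p i \<le> y i \<and> y i \<le> q i \<and> x i + y i = p i + q i) \<longrightarrow>
     f x + f y \<le> f p + f q}"

definition idcx :: "nat \<Rightarrow> ((nat \<Rightarrow> real) \<Rightarrow> real) set" where
  "idcx n = {f \<in> dcx n. \<forall>x\<in>vectors n. \<forall>y\<in>vectors n. (\<forall>i<n. x i \<le> y i) \<longrightarrow> f x \<le> f y}"

definition ddcx :: "nat \<Rightarrow> ((nat \<Rightarrow> real) \<Rightarrow> real) set" where
  "ddcx n = {f \<in> dcx n. \<forall>x\<in>vectors n. \<forall>y\<in>vectors n. (\<forall>i<n. x i \<le> y i) \<longrightarrow> f y \<le> f x}"

text \<open>
  \<open>integrable\<close> includes measurability of the composition. This excludes nothing for the vectors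
  of counts considered here: they take values in a countable set, so that any function of them
  is measurable.
\<close>

definition vector_le ::
    "((nat \<Rightarrow> real) \<Rightarrow> real) set \<Rightarrow> 'w measure \<Rightarrow> ('w \<Rightarrow> nat \<Rightarrow> real) \<Rightarrow>
     'v measure \<Rightarrow> ('v \<Rightarrow> nat \<Rightarrow> real) \<Rightarrow> bool" where
  "vector_le F M X N Y \<longleftrightarrow>
     (\<forall>f\<in>F. integrable M (\<lambda>\<omega>. f (X \<omega>)) \<and> integrable N (\<lambda>\<omega>. f (Y \<omega>)) \<longrightarrow>
        integral\<^sup>L M (\<lambda>\<omega>. f (X \<omega>)) \<le> integral\<^sup>L N (\<lambda>\<omega>. f (Y \<omega>)))"

definition counts :: "nat \<Rightarrow> (nat \<Rightarrow> 'a set) \<Rightarrow> 'a::euclidean_space measure \<Rightarrow> nat \<Rightarrow> real" where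
  "counts n B \<mu> = (\<lambda>i\<in>{..<n}. measure \<mu> (B i))"

definition process_le ::
    "(nat \<Rightarrow> ((nat \<Rightarrow> real) \<Rightarrow> real) set) \<Rightarrow>
     'a::euclidean_space measure measure \<Rightarrow> 'a measure measure \<Rightarrow> bool" where
  "process_le F \<Phi>1 \<Phi>2 \<longleftrightarrow>
     (\<forall>n B. (\<forall>i<n. B i \<in> bounded_borel) \<longrightarrow>
        vector_le (F n) \<Phi>1 (counts n B) \<Phi>2 (counts n B))"

definition dcx_sub_poisson :: "'a::euclidean_space measure measure \<Rightarrow> bool" where
  "dcx_sub_poisson \<Phi> \<longleftrightarrow> (\<exists>\<Lambda> \<Psi>. poisson_process \<Lambda> \<Psi> \<and> process_le dcx \<Phi> \<Psi>)"


section \<open>Joint intensities\<close>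

definition joint_intensity ::
    "'a::euclidean_space measure measure \<Rightarrow> nat \<Rightarrow> ((nat \<Rightarrow> 'a) \<Rightarrow> real) \<Rightarrow> bool" where
  "joint_intensity \<Phi> k \<rho> \<longleftrightarrow>
     \<rho> \<in> borel_measurable (\<Pi>\<^sub>M i\<in>{..<k}. lborel) \<and> (\<forall>x. 0 \<le> \<rho> x) \<and>
     (\<forall>B. (\<forall>i<k. B i \<in> bounded_borel) \<and> disjoint_family_on B {..<k} \<longrightarrow>
        (\<integral>\<^sup>+ \<mu>. (\<Prod>i<k. emeasure \<mu> (B i)) \<partial>\<Phi>) =
        (\<integral>\<^sup>+ x\<in>Pi\<^sub>E {..<k} B. ennreal (\<rho> x) \<partial>(\<Pi>\<^sub>M i\<in>{..<k}. lborel)))"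

definition weakly_sub_poisson :: "real \<Rightarrow> 'a::euclidean_space measure measure \<Rightarrow> bool" where
  "weakly_sub_poisson lam \<Phi> \<longleftrightarrow>
     (\<exists>\<rho>. \<forall>k\<ge>1. joint_intensity \<Phi> k (\<rho> k) \<and>
        (AE x in (\<Pi>\<^sub>M i\<in>{..<k}. lborel). \<rho> k x \<le> lam ^ k))"


section \<open>Boolean model\<close>

text \<open>
  The points of a configuration are its atoms. Closed balls are used; open balls give the same
  critical radius, because the percolating radii are upward closed in either case and a closed
  ball is contained in every open ball of larger radius with the same centre.
\<close>

definition points :: "'a::euclidean_space measure \<Rightarrow> 'a set" where
  "points \<mu> = {x. emeasure \<mu> {x} \<noteq> 0}"

definition boolean_model :: "'a::euclidean_space measure \<Rightarrow> real \<Rightarrow> 'a set" where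
  "boolean_model \<mu> r = (\<Union>x\<in>points \<mu>. cball x r)"

definition percolates :: "'a::euclidean_space set \<Rightarrow> bool" where
  "percolates A \<longleftrightarrow> (\<exists>S\<subseteq>A. connected S \<and> \<not> bounded S)"

definition critical_radius :: "'a::euclidean_space measure measure \<Rightarrow> ereal" where
  "critical_radius \<Phi> =
     (INF r\<in>{r. 0 < r \<and> measure \<Phi> {\<mu> \<in> space \<Phi>. percolates (boolean_model \<mu> r)} > 0}. ereal r)"

end

theory Submission
  imports Defs "HOL-Library.Transitive_Closure_Table"
begin

text \<open>
  Both bounds are first-moment arguments over self-avoiding lattice paths, and each needs the order
  only for the count of a single set, the union of the cells of a path.

  Lower bound: percolation at a small radius forces, for every \<open>n\<close>, a self-avoiding path of \<open>n + 1\<close>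
  occupied cells. Then the union of these cells carries at least \<open>n + 1\<close> points, which is controlled
  by the idcx function \<open>(x - n)\<^sup>+\<close>. As it grows only linearly, no moments beyond the mean are needed.
  The probability is at most \<open>e (e / a)\<^sup>n\<close>, where \<open>a\<close> is arbitrarily large for small cells, and beats
  the number of paths. In the weakly sub-Poisson case the joint intensity gives the same bound.

  Upper bound: the ddcx function \<open>(1 - x)\<^sup>+\<close> compares void probabilities, so large cells satisfy the
  hypothesis of a Peierls argument, carried out in a quadrant of a two-dimensional slice: a finite
  cluster of the corner is cut off by a path of void cells from one axis to the other.
\<close>

section \<open>Clusters of points\<close>

text \<open>Under the given process the states of the cells of a path are dependent, and no product
  bound is available for them. In the comparison with a Poisson process the union of the cells still
  yields one factor per cell: its volume is at most proportional to the length of the path for grid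
  cells and exactly proportional for the planar boxes, and the Poisson bounds are exponential in the
  volume. For occupied cells the factor comes from an exponential moment with parameter
  \<open>a\<close>. The branching number of the grid dictates how large \<open>a\<close> must be;
  only afterwards is the cell side chosen so small that the moment costs at most a factor e per
  cell. A quadrant is preferred to a full plane because the obstacle to percolation is then a path
  between two axes. No closed contours have to be enumerated, and a path starting at
  \<open>(i, 0)\<close> has at least \<open>i\<close> steps, so the union bound has one starting
  vertex for each length. Separation is proved by a potential modulo 2 in place of a Jordan curve
  argument.\<close>

lemma configuration_count:
  assumes "\<mu> \<in> configurations" "B \<in> bounded_borel"
  obtains k :: nat where "emeasure \<mu> B = of_nat k" "measure \<mu> B = real k"
proof -
  obtain k :: nat where "emeasure \<mu> B = of_nat k"
    using assms unfolding configurations_def Nats_def by auto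
  moreover from this have "measure \<mu> B = real k"
    by (simp add: measure_def ennreal_of_nat_eq_real_of_nat)
  ultimately show ?thesis using that by blast
qed

lemma configuration_ge_1:
  assumes "\<mu> \<in> configurations" "B \<in> bounded_borel" "emeasure \<mu> B \<noteq> 0"
  shows "1 \<le> emeasure \<mu> B"
proof -
  obtain k :: nat where k: "emeasure \<mu> B = of_nat k"
    using configuration_count[OF assms(1,2)] by metis
  with assms(3) have "1 \<le> k" by (cases k) auto
  then have "of_nat 1 \<le> (of_nat k :: ennreal)" by (rule of_nat_mono)
  then show ?thesis using k by simp
qed

lemma bounded_borelI: "B \<in> sets borel \<Longrightarrow> bounded B \<Longrightarrow> B \<in> bounded_borel"
  by (simp add: bounded_borel_def)

lemma cball_bounded_borel [simp]: "cball x r \<in> bounded_borel"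
  and ball_bounded_borel [simp]: "ball x r \<in> bounded_borel"
  and singleton_bounded_borel [simp]: "{x} \<in> bounded_borel"
  by (auto simp: bounded_borel_def)

lemma sets_configuration: "\<mu> \<in> configurations \<Longrightarrow> sets \<mu> = sets borel"
  by (simp add: configurations_def)

text \<open>The counts of balls shrinking to a point are integers tending to the mass of that point,
  so around a point that is not an atom some ball is already null. By the Lindelof property
  countably many null open sets would cover a set \<open>B\<close> without atoms.\<close>

lemma point_in_bounded_borel:
  fixes \<mu> :: "'a::euclidean_space measure"
  assumes \<mu>: "\<mu> \<in> configurations" and B: "B \<in> bounded_borel" and pos: "emeasure \<mu> B \<noteq> 0"
  obtains x where "x \<in> B" "x \<in> points \<mu>"
proof (rule ccontr)
  assume "\<not> thesis"
  note point = that
  have none: "emeasure \<mu> {x} = 0" if "x \<in> B" for x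
    using \<open>\<not> thesis\<close> that(1) point unfolding points_def by blast
  note [simp] = sets_configuration[OF \<mu>]
  have ex: "\<exists>n. emeasure \<mu> (ball x (1 / real (Suc n))) = 0" if "x \<in> B" for x
  proof (rule ccontr)
    assume "\<not> ?thesis"
    then have ge: "1 \<le> emeasure \<mu> (ball x (1 / real (Suc n)))" for n
      using configuration_ge_1[OF \<mu> ball_bounded_borel] by blast
    have "decseq (\<lambda>n. ball x (1 / real (Suc n)))"
      by (intro decseq_SucI subset_ball) (auto simp: field_simps)
    moreover have "(\<Inter>n. ball x (1 / real (Suc n))) = {x}"
    proof -
      have "y = x" if "\<And>n. dist x y < 1 / real (Suc n)" for y
      proof (rule ccontr)
        assume "y \<noteq> x"
        then obtain n where "1 / real (Suc n) < dist x y"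
          by (metis nat_approx_posE zero_less_dist_iff inverse_eq_divide)
        then show False using that[of n] by simp
      qed
      then show ?thesis by auto
    qed
    moreover have "emeasure \<mu> (ball x (1 / real (Suc n))) \<noteq> \<infinity>" for n
      using configuration_count[OF \<mu> ball_bounded_borel] by (metis ennreal_of_nat_neq_top infinity_ennreal_def)
    ultimately have "(\<lambda>n. emeasure \<mu> (ball x (1 / real (Suc n)))) \<longlonglongrightarrow> emeasure \<mu> {x}"
      using Lim_emeasure_decseq[of "\<lambda>n. ball x (1 / real (Suc n))" \<mu>] by (simp add: image_subset_iff)
    then have "1 \<le> emeasure \<mu> {x}" by (rule LIMSEQ_le_const) (use ge in auto)
    then show False using none[OF that] by simp
  qed
  let ?F = "{U. open U \<and> bounded U \<and> emeasure \<mu> U = 0}"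
  obtain F where F: "F \<subseteq> ?F" "countable F" "\<Union>F = \<Union>?F"
    using Lindelof[of ?F] by blast
  have "emeasure \<mu> (\<Union>F) = 0"
  proof -
    have "(\<Union>U\<in>F. U) \<in> null_sets \<mu>"
      by (rule null_sets_UN'[OF F(2)]) (use F(1) in \<open>auto simp: null_sets_def\<close>)
    then show ?thesis by (simp add: null_sets_def)
  qed
  moreover have "B \<subseteq> \<Union>F"
    unfolding F(3)
  proof
    fix x assume "x \<in> B"
    then obtain n where "emeasure \<mu> (ball x (1 / real (Suc n))) = 0" using ex by blast
    then have "ball x (1 / real (Suc n)) \<in> ?F" by auto
    moreover have "x \<in> ball x (1 / real (Suc n))" by simp
    ultimately show "x \<in> \<Union>?F" by blast
  qed
  moreover have "\<Union>F \<in> sets \<mu>" using F by (intro sets.countable_Union) auto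
  ultimately have "emeasure \<mu> B = 0" by (metis emeasure_mono le_zero_eq)
  with pos show False by blast
qed

lemma emeasure_pos_if_point:
  assumes "\<mu> \<in> configurations" "B \<in> sets borel" "x \<in> B" "x \<in> points \<mu>"
  shows "emeasure \<mu> B \<noteq> 0"
  using assms emeasure_mono[of "{x}" B \<mu>] sets_configuration[OF assms(1)] unfolding points_def by auto

lemma finite_points_bounded:
  fixes \<mu> :: "'a::euclidean_space measure"
  assumes \<mu>: "\<mu> \<in> configurations" and "bounded B"
  shows "finite (points \<mu> \<inter> B)"
proof (rule ccontr)
  assume inf: "infinite (points \<mu> \<inter> B)"
  note [simp] = sets_configuration[OF \<mu>]
  obtain r where r: "B \<subseteq> cball 0 r" using \<open>bounded B\<close> by (meson bounded_subset_ballD ball_subset_cball order_trans)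
  obtain k :: nat where k: "emeasure \<mu> (cball 0 r) = of_nat k"
    using configuration_count[OF \<mu> cball_bounded_borel] by metis
  obtain T where T: "T \<subseteq> points \<mu> \<inter> B" "finite T" "card T = Suc k"
    using infinite_arbitrarily_large[OF inf] by blast
  have "of_nat (Suc k) = (\<Sum>x\<in>T. 1 :: ennreal)" using T by simp
  also have "\<dots> \<le> (\<Sum>x\<in>T. emeasure \<mu> {x})"
    using T by (intro sum_mono configuration_ge_1[OF \<mu> singleton_bounded_borel]) (auto simp: points_def)
  also have "\<dots> = emeasure \<mu> T"
    using T by (intro emeasure_eq_sum_singleton[symmetric]) auto
  also have "\<dots> \<le> emeasure \<mu> (cball 0 r)"
    using T r by (intro emeasure_mono) auto
  finally show False using k
    by (simp only: of_nat_le_iff)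
qed

text \<open>For \<open>0 \<le> r\<close> two closed balls of radius \<open>r\<close> meet exactly
  when their centres have distance at most \<open>2 * r\<close>, so links record the overlaps in the
  Boolean model.\<close>

definition linked :: "'a::euclidean_space measure \<Rightarrow> real \<Rightarrow> 'a \<Rightarrow> 'a \<Rightarrow> bool" where
  "linked \<mu> r x y \<longleftrightarrow> x \<in> points \<mu> \<and> y \<in> points \<mu> \<and> dist x y \<le> 2 * r"

definition cluster :: "'a::euclidean_space measure \<Rightarrow> real \<Rightarrow> 'a \<Rightarrow> 'a set" where
  "cluster \<mu> r x = {y. (linked \<mu> r)\<^sup>*\<^sup>* x y}"

lemma cluster_points: "x \<in> points \<mu> \<Longrightarrow> cluster \<mu> r x \<subseteq> points \<mu>"
proof
  fix y assume "x \<in> points \<mu>" "y \<in> cluster \<mu> r x"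
  then have "(linked \<mu> r)\<^sup>*\<^sup>* x y" by (simp add: cluster_def)
  then show "y \<in> points \<mu>" by cases (use \<open>x \<in> points \<mu>\<close> in \<open>auto simp: linked_def\<close>)
qed

text \<open>Only finitely many of the balls reach a given bounded region, so their union is closed
  even if it is infinite. Closedness is what allows the balls of a cluster and those of the
  remaining points to separate a connected set.\<close>

lemma closed_Union_cballs:
  fixes \<mu> :: "'a::euclidean_space measure"
  assumes \<mu>: "\<mu> \<in> configurations" and T: "T \<subseteq> points \<mu>"
  shows "closed (\<Union>x\<in>T. cball x r)"
proof -
  have "closedin euclidean (\<Union>((\<lambda>x. cball x r) ` T))"
  proof (rule closedin_locally_finite_Union)
    have "\<exists>V. open V \<and> z \<in> V \<and> finite {U \<in> (\<lambda>x. cball x r) ` T. U \<inter> V \<noteq> {}}" for z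
    proof (intro exI[of _ "ball z 1"] conjI)
      have "{U \<in> (\<lambda>x. cball x r) ` T. U \<inter> ball z 1 \<noteq> {}} \<subseteq> (\<lambda>x. cball x r) ` (points \<mu> \<inter> cball z (r + 1))"
      proof clarify
        fix x y assume "x \<in> T" "cball x r \<inter> ball z 1 \<noteq> {}"
        then obtain y where "dist x y \<le> r" "dist z y < 1" by auto
        then have "dist z x \<le> r + 1" using dist_triangle2[of z x y] by simp
        then show "cball x r \<in> (\<lambda>x. cball x r) ` (points \<mu> \<inter> cball z (r + 1))"
          using \<open>x \<in> T\<close> T by auto
      qed
      then show "finite {U \<in> (\<lambda>x. cball x r) ` T. U \<inter> ball z 1 \<noteq> {}}"
        using finite_points_bounded[OF \<mu> bounded_cball] by (meson finite_imageI finite_subset)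
    qed auto
    then show "locally_finite_in euclidean ((\<lambda>x. cball x r) ` T)"
      by (auto simp: locally_finite_in_def)
  qed auto
  then show ?thesis by simp
qed

text \<open>The balls of a cluster and those of all other points form two disjoint closed sets, so a
  connected part of the model stays within distance \<open>r\<close> of a single cluster.
  Conversely, the balls of linked points share the midpoint of their centres, which makes the union
  over a cluster connected.\<close>

lemma percolates_iff_unbounded_cluster:
  fixes \<mu> :: "'a::euclidean_space measure"
  assumes \<mu>: "\<mu> \<in> configurations" and r: "0 < r"
  shows "percolates (boolean_model \<mu> r) \<longleftrightarrow> (\<exists>x\<in>points \<mu>. \<not> bounded (cluster \<mu> r x))"
proof
  assume "percolates (boolean_model \<mu> r)"
  then obtain S where S: "S \<subseteq> boolean_model \<mu> r" "connected S" "\<not> bounded S"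
    unfolding percolates_def by blast
  obtain s where "s \<in> S" using S(3) by (metis bounded_empty ex_in_conv)
  then obtain x where x: "x \<in> points \<mu>" "s \<in> cball x r" using S(1) unfolding boolean_model_def by blast
  define K where "K = cluster \<mu> r x"
  have K: "K \<subseteq> points \<mu>" unfolding K_def using x(1) by (rule cluster_points)
  have "x \<in> K" by (simp add: K_def cluster_def)
  let ?U = "\<Union>y\<in>K. cball y r" and ?V = "\<Union>y\<in>points \<mu> - K. cball y r"
  have disj: "?U \<inter> ?V = {}"
  proof (rule ccontr)
    assume "?U \<inter> ?V \<noteq> {}"
    then obtain y z w where *: "y \<in> K" "z \<in> points \<mu> - K" "dist y w \<le> r" "dist z w \<le> r"
      unfolding disjoint_iff UN_iff mem_cball by blast
    then have "dist y z \<le> 2 * r" using dist_triangle2[of y z w] by simp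
    then have "linked \<mu> r y z" using * K by (auto simp: linked_def)
    then have "z \<in> K" using *(1) unfolding K_def cluster_def by auto
    then show False using * by blast
  qed
  have "S \<subseteq> ?U \<union> ?V" using S(1) unfolding boolean_model_def by auto
  moreover have "closed ?U" "closed ?V" using closed_Union_cballs[OF \<mu>] K by auto
  ultimately have "?U \<inter> S = {} \<or> ?V \<inter> S = {}"
    using S(2) disj unfolding connected_closed by blast
  moreover have "s \<in> ?U \<inter> S" using \<open>s \<in> S\<close> \<open>x \<in> K\<close> x(2) by blast
  ultimately have "S \<subseteq> ?U" using \<open>S \<subseteq> ?U \<union> ?V\<close> by blast
  have "\<not> bounded K"
  proof
    assume "bounded K"
    then obtain e where "\<And>y. y \<in> K \<Longrightarrow> norm y \<le> e" unfolding bounded_iff by blast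
    have "norm w \<le> e + r" if w: "w \<in> S" for w
    proof -
      obtain y where "y \<in> K" "dist y w \<le> r" using \<open>S \<subseteq> ?U\<close> w by auto
      then show ?thesis using \<open>\<And>y. y \<in> K \<Longrightarrow> norm y \<le> e\<close>[of y] norm_triangle_sub[of w y]
        by (simp add: dist_norm norm_minus_commute)
    qed
    then show False using S(3) unfolding bounded_iff by blast
  qed
  then show "\<exists>x\<in>points \<mu>. \<not> bounded (cluster \<mu> r x)" using x(1) K_def by blast
next
  assume "\<exists>x\<in>points \<mu>. \<not> bounded (cluster \<mu> r x)"
  then obtain x where x: "x \<in> points \<mu>" "\<not> bounded (cluster \<mu> r x)" by blast
  let ?S = "\<Union>y\<in>cluster \<mu> r x. cball y r"
  have "?S \<subseteq> boolean_model \<mu> r"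
    using cluster_points[OF x(1)] unfolding boolean_model_def by blast
  moreover have "\<exists>T\<subseteq>?S. connected T \<and> x \<in> T \<and> y \<in> T" if "(linked \<mu> r)\<^sup>*\<^sup>* x y" for y
    using that
  proof induction
    case base
    show ?case by (rule exI[of _ "{x}"]) (use r in \<open>auto simp: cluster_def\<close>)
  next
    case (step y z)
    then obtain T where T: "T \<subseteq> ?S" "connected T" "x \<in> T" "y \<in> T" by blast
    have yz: "y \<in> cluster \<mu> r x" "z \<in> cluster \<mu> r x" using step by (auto simp: cluster_def)
    have "midpoint y z \<in> cball y r \<inter> cball z r"
      using step(2) by (auto simp: linked_def dist_midpoint)
    then have "connected (cball y r \<union> cball z r)" by (intro connected_Un) auto
    moreover have "y \<in> T \<inter> (cball y r \<union> cball z r)" using T r by auto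
    then have "T \<inter> (cball y r \<union> cball z r) \<noteq> {}" by blast
    ultimately have "connected (T \<union> (cball y r \<union> cball z r))"
      by (rule connected_Un[OF T(2)])
    then show ?case using T yz r by (intro exI[of _ "T \<union> (cball y r \<union> cball z r)"]) auto
  qed
  then have "connected ?S"
  proof -
    assume *: "\<And>y. (linked \<mu> r)\<^sup>*\<^sup>* x y \<Longrightarrow> \<exists>T\<subseteq>?S. connected T \<and> x \<in> T \<and> y \<in> T"
    have "\<exists>T\<subseteq>?S. connected T \<and> x \<in> T \<and> w \<in> T" if w: "w \<in> ?S" for w
    proof -
      obtain y where y: "y \<in> cluster \<mu> r x" "w \<in> cball y r" using w by blast
      then obtain T where T: "T \<subseteq> ?S" "connected T" "x \<in> T" "y \<in> T" using * unfolding cluster_def by blast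
      have "y \<in> T \<inter> cball y r" using T r by simp
      then have "T \<inter> cball y r \<noteq> {}" by blast
      then have "connected (T \<union> cball y r)" by (rule connected_Un[OF T(2) connected_cball])
      then show ?thesis using T y by (intro exI[of _ "T \<union> cball y r"]) auto
    qed
    then have eq: "?S = \<Union>{T. T \<subseteq> ?S \<and> connected T \<and> x \<in> T}" by blast
    show ?thesis by (subst eq) (rule connected_Union, auto)
  qed
  moreover have "cluster \<mu> r x \<subseteq> ?S" using r by auto
  then have "\<not> bounded ?S" using x(2) bounded_subset by blast
  ultimately show "percolates (boolean_model \<mu> r)" unfolding percolates_def by blast
qed

section \<open>Measurability of percolation\<close>

lemma space_configuration_space [simp]: "space configuration_space = configurations"
  unfolding configuration_space_def by (rule space_measure_of) auto

lemma sets_configuration_space: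
  "sets configuration_space = sigma_sets configurations
     {{\<mu> \<in> configurations. emeasure \<mu> B \<in> A} | B A. B \<in> bounded_borel \<and> A \<in> sets borel}"
  unfolding configuration_space_def by (rule sets_measure_of) auto

lemma measurable_count [measurable]:
  assumes "B \<in> bounded_borel"
  shows "(\<lambda>\<mu>. emeasure \<mu> B) \<in> borel_measurable configuration_space"
proof (rule measurableI)
  fix A :: "ennreal set" assume "A \<in> sets borel"
  then have "{\<mu> \<in> configurations. emeasure \<mu> B \<in> A} \<in> sets configuration_space"
    unfolding sets_configuration_space using assms by (intro sigma_sets.Basic) blast
  moreover have "(\<lambda>\<mu>. emeasure \<mu> B) -` A \<inter> space configuration_space = {\<mu> \<in> configurations. emeasure \<mu> B \<in> A}"
    by auto
  ultimately show "(\<lambda>\<mu>. emeasure \<mu> B) -` A \<inter> space configuration_space \<in> sets configuration_space"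
    by simp
qed simp

lemma measurable_measure_count:
  assumes "B \<in> bounded_borel"
  shows "(\<lambda>\<mu>. measure \<mu> B) \<in> borel_measurable configuration_space"
  unfolding measure_def using measurable_count[OF assms] by measurable

text \<open>
  The upper bound needs the percolation event to be measurable, since \<open>measure\<close> is \<open>0\<close> on
  non-measurable sets. Chains of points are approximated by chains in a countable dense set;
  local finiteness makes the approximation exact as \<open>j\<close> tends to infinity.
\<close>

definition near :: "'a::euclidean_space set \<Rightarrow> real \<Rightarrow> nat \<Rightarrow> 'a measure \<Rightarrow> 'a \<Rightarrow> 'a \<Rightarrow> bool" where
  "near D r j \<mu> p q \<longleftrightarrow> p \<in> D \<and> q \<in> D \<and> dist p q \<le> 2 * r + 2 / real (Suc j) \<and>
     emeasure \<mu> (ball p (1 / real (Suc j))) \<noteq> 0 \<and> emeasure \<mu> (ball q (1 / real (Suc j))) \<noteq> 0"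

text \<open>Reachability is a countable union over the length of the chain and, step by step, over
  the intermediate vertex in \<open>D\<close>.\<close>

lemma measurable_near_chain:
  assumes "countable D"
  shows "{\<mu> \<in> configurations. (near D r j \<mu>)\<^sup>*\<^sup>* p q} \<in> sets configuration_space"
proof -
  have near: "Measurable.pred configuration_space (\<lambda>\<mu>. near D r j \<mu> p q)" for p q
  proof -
    have "(\<lambda>\<mu>. emeasure \<mu> (ball p (1 / real (Suc j)))) \<in> borel_measurable configuration_space" for p :: 'a
      by (rule measurable_count) simp
    then show ?thesis unfolding near_def by measurable
  qed
  have "{\<mu> \<in> configurations. (near D r j \<mu> ^^ n) p q} \<in> sets configuration_space" for n q
  proof (induction n arbitrary: q)
    case 0
    then show ?case using sets.top[of configuration_space] by (cases "p = q") auto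
  next
    case (Suc n)
    have "{\<mu> \<in> configurations. (near D r j \<mu> ^^ Suc n) p q} =
      (\<Union>z\<in>D. {\<mu> \<in> configurations. (near D r j \<mu> ^^ n) p z} \<inter> {\<mu> \<in> configurations. near D r j \<mu> z q})"
      by (auto simp: relcompp_apply near_def)
    also have "\<dots> \<in> sets configuration_space"
      using Suc near assms by (intro sets.countable_UN' sets.Int) (auto simp: pred_def)
    finally show ?case .
  qed
  then have "(\<Union>n. {\<mu> \<in> configurations. (near D r j \<mu> ^^ n) p q}) \<in> sets configuration_space"
    by (intro sets.countable_nat_UN) auto
  moreover have "(\<Union>n. {\<mu> \<in> configurations. (near D r j \<mu> ^^ n) p q}) =
      {\<mu> \<in> configurations. (near D r j \<mu>)\<^sup>*\<^sup>* p q}"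
    by (auto simp: rtranclp_power)
  ultimately show ?thesis by simp
qed

text \<open>Rounding to \<open>D\<close> moves each end of a link by less than
  \<open>1 / real (Suc j)\<close>, which accounts for the slack \<open>2 / real (Suc j)\<close> in
  \<open>near\<close>.\<close>

lemma linked_chain_imp_near_chain:
  assumes \<mu>: "\<mu> \<in> configurations" and chain: "(linked \<mu> r)\<^sup>*\<^sup>* x y"
    and d: "\<And>z. d z \<in> D" "\<And>z. dist z (d z) < 1 / real (Suc j)"
  shows "(near D r j \<mu>)\<^sup>*\<^sup>* (d x) (d y)"
  using chain
proof induction
  case (step y z)
  have "emeasure \<mu> (ball (d u) (1 / real (Suc j))) \<noteq> 0" if "u \<in> points \<mu>" for u
    using d(2)[of u] that by (intro emeasure_pos_if_point[OF \<mu>, of _ u]) (auto simp: dist_commute)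
  moreover have "dist (d y) (d z) \<le> 2 * r + 2 / real (Suc j)"
  proof -
    have "dist (d y) (d z) \<le> dist y (d y) + dist y z + dist z (d z)"
      using dist_triangle[of "d y" "d z" y] dist_triangle[of y "d z" z] by (simp add: dist_commute)
    moreover have "dist y z \<le> 2 * r" using step(2) by (simp add: linked_def)
    ultimately show ?thesis using d(2)[of y] d(2)[of z] by simp
  qed
  ultimately have "near D r j \<mu> (d y) (d z)"
    using step(2) d(1) by (auto simp: near_def linked_def)
  then show ?case using step.IH by simp
qed simp

text \<open>Going back from \<open>D\<close> to points costs the same slack once more, hence
  \<open>4 / real (Suc j)\<close>. The hypothesis \<open>gap\<close> removes it, but only in a
  bounded region, so the chain is followed until the cluster leaves the ball of radius
  \<open>R\<close>. A step from inside that ball ends within norm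
  \<open>R + 2 * r + 4\<close>.\<close>

lemma near_chain_imp_linked_chain:
  fixes \<mu> :: "'a::euclidean_space measure"
  assumes \<mu>: "\<mu> \<in> configurations" and r: "0 < r"
    and gap: "\<And>u v. u \<in> points \<mu> \<Longrightarrow> v \<in> points \<mu> \<Longrightarrow> norm u \<le> R \<Longrightarrow> norm v \<le> R + 2 * r + 4 \<Longrightarrow>
      dist u v \<le> 2 * r + 4 / real (Suc j) \<Longrightarrow> dist u v \<le> 2 * r"
    and x: "x \<in> points \<mu>" "dist x p < 1 / real (Suc j)"
    and chain: "(near D r j \<mu>)\<^sup>*\<^sup>* p q"
  shows "\<exists>z\<in>cluster \<mu> r x. R < norm z \<or> dist z q < 1 / real (Suc j)"
  using chain
proof induction
  case base
  show ?case using x(2) by (intro bexI[of _ x]) (auto simp: cluster_def)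
next
  case (step q q')
  then obtain z where z: "z \<in> cluster \<mu> r x" "R < norm z \<or> dist z q < 1 / real (Suc j)" by blast
  show ?case
  proof (cases "R < norm z")
    case False
    with z have zq: "dist z q < 1 / real (Suc j)" by blast
    obtain z' where z': "z' \<in> ball q' (1 / real (Suc j))" "z' \<in> points \<mu>"
      using point_in_bounded_borel[OF \<mu> ball_bounded_borel, of q' "1 / real (Suc j)"] step(2)
      unfolding near_def by blast
    have "dist z z' \<le> dist z q + dist q q' + dist q' z'"
      using dist_triangle[of z z' q] dist_triangle[of q z' q'] by simp
    moreover have "dist q q' \<le> 2 * r + 2 / real (Suc j)" using step(2) by (simp add: near_def)
    ultimately have le: "dist z z' \<le> 2 * r + 4 / real (Suc j)" using zq z'(1) by simp
    have "4 / real (Suc j) \<le> 4" by (simp add: field_simps)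
    then have "norm z' \<le> R + 2 * r + 4"
      using le False norm_triangle_sub[of z' z] by (simp add: dist_norm norm_minus_commute)
    moreover have "z \<in> points \<mu>" using cluster_points[OF x(1)] z(1) by blast
    ultimately have "linked \<mu> r z z'"
      using gap[of z z'] le False z'(2) by (auto simp: linked_def)
    then have "z' \<in> cluster \<mu> r x" using z(1) by (auto simp: cluster_def)
    then show ?thesis using z'(1) by (auto simp: dist_commute)
  qed (use z in blast)
qed

lemma norm_le_norm_add_1: "dist a b < 1 / real (Suc j) \<Longrightarrow> norm a \<le> norm (b::'a::real_normed_vector) + 1"
proof -
  assume "dist a b < 1 / real (Suc j)"
  also have "1 / real (Suc j) \<le> 1" by simp
  finally show ?thesis using norm_triangle_sub[of a b] by (simp add: dist_norm)
qed

text \<open>The bound \<open>m\<close> confines the starts of all chains to a region with finitely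
  many points. Without it the starts could escape to infinity together with \<open>n\<close>, and
  distant ends would not produce one unbounded cluster.\<close>

lemma unbounded_cluster_iff_near_chains:
  fixes \<mu> :: "'a::euclidean_space measure"
  assumes \<mu>: "\<mu> \<in> configurations" and r: "0 < r"
    and dense: "\<And>z e. 0 < e \<Longrightarrow> \<exists>d\<in>D. dist z d < e"
  shows "(\<exists>x\<in>points \<mu>. \<not> bounded (cluster \<mu> r x)) \<longleftrightarrow>
    (\<exists>m::nat. \<forall>n::nat. \<forall>j. \<exists>p\<in>D. \<exists>q\<in>D. norm p \<le> m \<and> n \<le> norm q \<and>
        emeasure \<mu> (ball p (1 / real (Suc j))) \<noteq> 0 \<and> (near D r j \<mu>)\<^sup>*\<^sup>* p q)" (is "?L \<longleftrightarrow> ?R")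
proof
  assume ?L
  then obtain x where x: "x \<in> points \<mu>" "\<not> bounded (cluster \<mu> r x)" by blast
  obtain m :: nat where m: "norm x + 1 \<le> m" using real_arch_simple by blast
  have "\<exists>p\<in>D. \<exists>q\<in>D. norm p \<le> m \<and> n \<le> norm q \<and>
      emeasure \<mu> (ball p (1 / real (Suc j))) \<noteq> 0 \<and> (near D r j \<mu>)\<^sup>*\<^sup>* p q" for n j :: nat
  proof -
    have "\<exists>d. \<forall>z. d z \<in> D \<and> dist z (d z) < 1 / real (Suc j)"
      by (rule choice) (use dense[of "1 / real (Suc j)"] in auto)
    then obtain d where d: "\<And>z. d z \<in> D" "\<And>z. dist z (d z) < 1 / real (Suc j)" by blast
    obtain y where y: "y \<in> cluster \<mu> r x" "n + 1 < norm y"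
      using x(2) unfolding bounded_iff by (metis linorder_not_less)
    have near1: "norm z \<le> norm (d z) + 1" "norm (d z) \<le> norm z + 1" for z
      using d(2)[of z] by (auto intro: norm_le_norm_add_1 simp: dist_commute simp del: of_nat_Suc)
    have "norm (d x) \<le> m" using near1[of x] m by simp
    moreover have "n \<le> norm (d y)" using near1[of y] y by simp
    moreover have "emeasure \<mu> (ball (d x) (1 / real (Suc j))) \<noteq> 0"
      using d(2)[of x] x(1) by (intro emeasure_pos_if_point[OF \<mu>, of _ x]) (auto simp: dist_commute)
    moreover have "(near D r j \<mu>)\<^sup>*\<^sup>* (d x) (d y)"
      using y(1) by (intro linked_chain_imp_near_chain[OF \<mu> _ d]) (auto simp: cluster_def)
    ultimately show ?thesis using d(1) by blast
  qed
  then show ?R by blast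
next
  assume ?R
  then obtain m :: nat where m: "\<And>n j. \<exists>p\<in>D. \<exists>q\<in>D. norm p \<le> m \<and> real n \<le> norm q \<and>
        emeasure \<mu> (ball p (1 / real (Suc j))) \<noteq> 0 \<and> (near D r j \<mu>)\<^sup>*\<^sup>* p q"
    by blast
  let ?F = "points \<mu> \<inter> cball 0 (m + 1)"
  have ex: "\<exists>x\<in>?F. \<exists>z\<in>cluster \<mu> r x. n \<le> norm z" for n :: nat
  proof -
    let ?G = "points \<mu> \<inter> cball 0 (n + 2 * r + 4)"
    \<comment> \<open>The finitely many positive excesses of distances over \<open>2 * r\<close>
      have a positive lower bound \<open>e\<close>; once \<open>4 / real (Suc j)\<close> is below
      \<open>e\<close>, the slack cannot create a false link.\<close>
    let ?d = "(\<lambda>(u, v). dist u v - 2 * r) ` (?G \<times> ?G) \<inter> {0<..}"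
    have "finite ?d" using finite_points_bounded[OF \<mu> bounded_cball] by blast
    then obtain e where e: "0 < e" "\<And>t. t \<in> ?d \<Longrightarrow> e \<le> t"
    proof (cases "?d = {}")
      case False
      then show ?thesis
        using \<open>finite ?d\<close> that[of "Min ?d"] Min_in[OF \<open>finite ?d\<close>] by auto
    qed (use that[of 1] in auto)
    obtain j where j: "4 / e < real (Suc j)"
      using reals_Archimedean2 by (meson less_SucI of_nat_less_iff order_less_trans lessI)
    then have "4 / real (Suc j) < e" using e(1) by (simp add: field_simps)
    then have gap: "dist u v \<le> 2 * r" if "u \<in> points \<mu>" "v \<in> points \<mu>" "norm u \<le> n" "norm v \<le> n + 2 * r + 4"
        "dist u v \<le> 2 * r + 4 / real (Suc j)" for u v
    proof -
      have "u \<in> ?G" "v \<in> ?G" using that r by auto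
      then have "dist u v - 2 * r \<notin> {0<..} \<or> e \<le> dist u v - 2 * r" using e(2) by blast
      then show ?thesis using that(5) \<open>4 / real (Suc j) < e\<close> by auto
    qed
    \<comment> \<open>The extra 1 pays for passing from \<open>q\<close> to a point within distance
      1 of it.\<close>
    obtain p q where pq: "norm p \<le> m" "real (n + 1) \<le> norm q"
        "emeasure \<mu> (ball p (1 / real (Suc j))) \<noteq> 0" "(near D r j \<mu>)\<^sup>*\<^sup>* p q"
      using m by blast
    obtain x where x: "x \<in> ball p (1 / real (Suc j))" "x \<in> points \<mu>"
      using point_in_bounded_borel[OF \<mu> ball_bounded_borel pq(3)] by blast
    obtain z where z: "z \<in> cluster \<mu> r x" "n < norm z \<or> dist z q < 1 / real (Suc j)"
      using near_chain_imp_linked_chain[OF \<mu> r gap x(2) _ pq(4)] x(1) by (auto simp: dist_commute)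
    have "n \<le> norm z" using z(2) norm_le_norm_add_1[of q z j] pq(2) by (auto simp: dist_commute simp del: of_nat_Suc)
    moreover have "x \<in> ?F" using x norm_le_norm_add_1[of x p j] pq(1) by (auto simp: dist_commute simp del: of_nat_Suc)
    ultimately show ?thesis using z(1) by blast
  qed
  show ?L
  proof (rule ccontr)
    assume "\<not> ?L"
    \<comment> \<open>The starting point in \<open>ex\<close> varies with \<open>n\<close> but stays
      in the finite set \<open>?F\<close>, so bounded clusters would have a common bound.\<close>
    then have "bounded (\<Union>x\<in>?F. cluster \<mu> r x)"
      using finite_points_bounded[OF \<mu> bounded_cball] by (intro bounded_UN) auto
    then obtain b where b: "\<And>z. z \<in> (\<Union>x\<in>?F. cluster \<mu> r x) \<Longrightarrow> norm z \<le> b" unfolding bounded_iff by blast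
    obtain n :: nat where "b < n" using reals_Archimedean2 by blast
    then show False using ex[of n] b by fastforce
  qed
qed

lemma percolation_event_measurable:
  assumes "0 < r"
  shows "{\<mu> \<in> configurations. percolates (boolean_model \<mu> r)} \<in> sets (configuration_space :: 'a::euclidean_space measure measure)"
proof -
  obtain D :: "'a set" where D: "countable D" "\<And>X. open X \<Longrightarrow> X \<noteq> {} \<Longrightarrow> \<exists>d\<in>D. d \<in> X"
    by (rule countable_dense_setE) blast
  have dense: "\<exists>d\<in>D. dist z d < e" if "0 < e" for z e
    using D(2)[of "ball z e"] that by (auto simp: mem_ball)
  let ?A = "\<lambda>j p q. {\<mu> \<in> configurations. emeasure \<mu> (ball p (1 / real (Suc j))) \<noteq> 0} \<inter>
      {\<mu> \<in> configurations. (near D r j \<mu>)\<^sup>*\<^sup>* p q}"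
  have A: "?A j p q \<in> sets configuration_space" for j p q
  proof (rule sets.Int[OF _ measurable_near_chain[OF D(1)]])
    have "(\<lambda>\<mu>. emeasure \<mu> (ball p (1 / real (Suc j)))) \<in> borel_measurable configuration_space"
      by (rule measurable_count) simp
    then have "{\<mu> \<in> space configuration_space. emeasure \<mu> (ball p (1 / real (Suc j))) \<noteq> 0} \<in> sets configuration_space"
      by measurable
    then show "{\<mu> \<in> configurations. emeasure \<mu> (ball p (1 / real (Suc j))) \<noteq> 0} \<in> sets configuration_space"
      by simp
  qed
  have "{\<mu> \<in> configurations. percolates (boolean_model \<mu> r)} =
    (\<Union>m::nat. \<Inter>n::nat. \<Inter>j. \<Union>p\<in>{p\<in>D. norm p \<le> m}. \<Union>q\<in>{q\<in>D. n \<le> norm q}. ?A j p q)"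
    (is "?P = ?Q")
  proof (rule set_eqI)
    fix \<mu> :: "'a measure"
    show "\<mu> \<in> ?P \<longleftrightarrow> \<mu> \<in> ?Q"
    proof (cases "\<mu> \<in> configurations")
      case True
      note eq = trans[OF percolates_iff_unbounded_cluster[OF True assms]
          unbounded_cluster_iff_near_chains[OF True assms dense]]
      show ?thesis
        unfolding mem_Collect_eq UN_iff INT_iff Int_iff using eq True by blast
    qed blast
  qed
  also have "\<dots> \<in> sets configuration_space"
    using D(1) by (intro sets.countable_nat_UN sets.countable_INT sets.countable_UN' A image_subsetI) auto
  finally show ?thesis .
qed

section \<open>Self-avoiding walks and separating paths\<close>

definition adjacent :: "nat \<times> nat \<Rightarrow> nat \<times> nat \<Rightarrow> bool" where
  "adjacent u v \<longleftrightarrow>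
     (fst u = fst v \<and> (snd u = Suc (snd v) \<or> snd v = Suc (snd u))) \<or>
     (snd u = snd v \<and> (fst u = Suc (fst v) \<or> fst v = Suc (fst u)))"

text \<open>King moves, with \<open>u\<close> itself included; truncated subtraction keeps the box
  inside the quadrant. Diagonal moves are needed because the outer boundary of a cluster for
  \<open>adjacent\<close> need not be connected without them.\<close>

definition star_nbrs :: "nat \<times> nat \<Rightarrow> (nat \<times> nat) set" where
  "star_nbrs u = {fst u - 1..fst u + 1} \<times> {snd u - 1..snd u + 1}"

text \<open>
  \<open>H i j\<close> and \<open>V i j\<close> are the values of a cochain modulo 2 on the edges from \<open>(i, j)\<close> to
  \<open>(i + 1, j)\<close> and to \<open>(i, j + 1)\<close>; this is the discrete Poincare lemma.
\<close>

lemma closed_grid_cochain_exact: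
  fixes H V :: "nat \<Rightarrow> nat \<Rightarrow> bool"
  assumes "\<And>i j. (H i j \<noteq> V (Suc i) j) = (V i j \<noteq> H i (Suc j))"
  obtains h where "\<And>i j. (h (Suc i) j \<noteq> h i j) = H i j" "\<And>i j. (h i (Suc j) \<noteq> h i j) = V i j"
    "\<not> h 0 (0::nat)"
proof -
  define g where "g = rec_nat False (\<lambda>i b. b \<noteq> H i 0)"
  define h where "h = (\<lambda>i. rec_nat (g i) (\<lambda>j b. b \<noteq> V i j))"
  have "(h (Suc i) j \<noteq> h i j) = H i j" for i j
    by (induction j) (use assms in \<open>auto simp: h_def g_def\<close>)
  moreover have "(h i (Suc j) \<noteq> h i j) = V i j" for i j
    by (auto simp: h_def)
  moreover have "\<not> h 0 0" by (simp add: h_def g_def)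
  ultimately show ?thesis using that by blast
qed

text \<open>
  Restrict the coboundary of \<open>K\<close> to the edges whose outer endpoint is joined to the first axis by a
  path in \<open>C\<close>. Endpoints on a common unit square are neighbours, so the restriction is again closed,
  hence the coboundary of some \<open>h\<close>. If no path reached the second axis, then \<open>h\<close> would vanish there
  but be 1 far out on the first axis, although it is constant outside \<open>K\<close> far from the corner.
\<close>

lemma separating_star_path:
  assumes K: "finite K" "(0, 0) \<in> K"
    and boundary: "\<And>u v. u \<in> K \<Longrightarrow> v \<notin> K \<Longrightarrow> adjacent u v \<Longrightarrow> v \<in> C"
  obtains i j where "(i, 0) \<in> C" "(\<lambda>u v. v \<in> C \<and> v \<in> star_nbrs u)\<^sup>*\<^sup>* (i, 0) (0, j)"
proof (rule ccontr)
  assume "\<not> thesis"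
  note result = that
  define R where "R = (\<lambda>u v. v \<in> C \<and> v \<in> star_nbrs u)"
  have no: "\<not> R\<^sup>*\<^sup>* (i, 0) (0, j)" if "(i, 0) \<in> C" for i j
    using that \<open>\<not> thesis\<close> result unfolding R_def by blast
  define S where "S = {v. \<exists>i. (i, 0) \<in> C \<and> R\<^sup>*\<^sup>* (i, 0) v}"
  have S_step: "v \<in> S" if "u \<in> S" "v \<in> C" "v \<in> star_nbrs u" for u v
    using that unfolding S_def R_def
    by (auto intro: rtranclp.rtrancl_into_rtrancl)
  have S_axis: "(i, 0) \<in> S" if "(i, 0) \<in> C" for i
    using that unfolding S_def by auto
  have S_no: "(0, j) \<notin> S" for j
    using no unfolding S_def by auto
  define w where "w = (\<lambda>a b. (a \<in> K \<and> b \<notin> K \<and> b \<in> S) \<or> (b \<in> K \<and> a \<notin> K \<and> a \<in> S))"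
  have closed: "(w (i, j) (Suc i, j) \<noteq> w (Suc i, j) (Suc i, Suc j)) =
      (w (i, j) (i, Suc j) \<noteq> w (i, Suc j) (Suc i, Suc j))" for i j
  proof -
    let ?Q = "{(i, j), (Suc i, j), (Suc i, Suc j), (i, Suc j)}"
    have st: "q \<in> star_nbrs p" if "p \<in> ?Q" "q \<in> ?Q" for p q
      using that by (auto simp: star_nbrs_def)
    have eq: "p \<in> S \<longleftrightarrow> q \<in> S" if "p \<in> ?Q" "q \<in> ?Q" "p \<in> C" "q \<in> C" for p q
      using that S_step st by metis
    let ?a = "(i, j)" let ?b = "(Suc i, j)" let ?c = "(Suc i, Suc j)" let ?d = "(i, Suc j)"
    have adj: "adjacent ?a ?b" "adjacent ?b ?a" "adjacent ?b ?c" "adjacent ?c ?b"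
      "adjacent ?c ?d" "adjacent ?d ?c" "adjacent ?d ?a" "adjacent ?a ?d"
      by (auto simp: adjacent_def)
    note bd = adj[THEN boundary[rotated 2]]
    show ?thesis
    \<comment> \<open>Either every corner in \<open>C\<close> belongs to \<open>S\<close>, and
      \<open>w\<close> is the full coboundary of \<open>K\<close> on this square, or none does, and
      \<open>w\<close> vanishes on it.\<close>
    proof (cases "\<exists>p\<in>?Q. p \<in> C \<and> p \<in> S")
      case True
      then have "q \<in> S" if "q \<in> ?Q" "q \<in> C" for q using that eq by blast
      then have S: "?a \<in> C \<Longrightarrow> ?a \<in> S" "?b \<in> C \<Longrightarrow> ?b \<in> S" "?c \<in> C \<Longrightarrow> ?c \<in> S" "?d \<in> C \<Longrightarrow> ?d \<in> S"
        by auto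
      have "w ?a ?b = ((?a \<in> K) \<noteq> (?b \<in> K))" "w ?b ?c = ((?b \<in> K) \<noteq> (?c \<in> K))"
        "w ?a ?d = ((?a \<in> K) \<noteq> (?d \<in> K))" "w ?d ?c = ((?d \<in> K) \<noteq> (?c \<in> K))"
        unfolding w_def using bd S by blast+
      then show ?thesis by blast
    next
      case False
      then have S: "?a \<notin> C \<or> ?a \<notin> S" "?b \<notin> C \<or> ?b \<notin> S" "?c \<notin> C \<or> ?c \<notin> S" "?d \<notin> C \<or> ?d \<notin> S"
        by auto
      have "\<not> w ?a ?b" "\<not> w ?b ?c" "\<not> w ?a ?d" "\<not> w ?d ?c"
        unfolding w_def using bd S by blast+
      then show ?thesis by blast
    qed
  qed
  obtain h where hH: "\<And>i j. (h (Suc i) j \<noteq> h i j) = w (i, j) (Suc i, j)"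
    and hV: "\<And>i j. (h i (Suc j) \<noteq> h i j) = w (i, j) (i, Suc j)" and h0: "\<not> h 0 (0::nat)"
    by (rule closed_grid_cochain_exact[of "\<lambda>i j. w (i, j) (Suc i, j)" "\<lambda>i j. w (i, j) (i, Suc j)"])
      (rule closed, rule that)
  obtain n where n: "\<And>i j. (i, j) \<in> K \<Longrightarrow> i < n \<and> j < n"
  proof -
    obtain n where "\<forall>k\<in>fst ` K \<union> snd ` K. k < n"
      using K(1) finite_nat_set_iff_bounded[of "fst ` K \<union> snd ` K"] by auto
    then have "i < n \<and> j < n" if "(i, j) \<in> K" for i j
      using that by (metis UnCI fst_conv image_eqI snd_conv)
    then show ?thesis by (rule that)
  qed
  have K_lt: "(n, j) \<notin> K" "(i, n) \<notin> K" for i j using n by blast+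
  \<comment> \<open>On the first axis every vertex of \<open>C\<close> lies in \<open>S\<close> by
    the empty path, so \<open>w\<close> is the full coboundary of \<open>K\<close> there and
    \<open>h\<close> is the indicator of the complement of \<open>K\<close>.\<close>
  have x_axis: "h i 0 \<longleftrightarrow> (i, 0) \<notin> K" for i
  proof (induction i)
    case (Suc i)
    have "w (i, 0) (Suc i, 0) \<longleftrightarrow> ((i, 0) \<in> K) \<noteq> ((Suc i, 0) \<in> K)"
      using boundary[of "(i,0)" "(Suc i,0)"] boundary[of "(Suc i,0)" "(i,0)"] S_axis
      unfolding w_def by (auto simp: adjacent_def)
    then show ?case using hH[of i 0] Suc by blast
  qed (use h0 K in auto)
  have y_axis: "\<not> h 0 j" for j
  proof (induction j)
    case (Suc j)
    have "\<not> w (0, j) (0, Suc j)" using S_no by (simp add: w_def)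
    then show ?case using hV[of 0 j] Suc by blast
  qed (rule h0)
  \<comment> \<open>No edge outside \<open>K\<close> is marked, so going up column \<open>n\<close>
    and back along row \<open>n\<close> carries the value 1 from the first axis to the
    second.\<close>
  have right: "h n j" for j
  proof (induction j)
    case 0 then show ?case using x_axis K_lt by blast
  next
    case (Suc j)
    have "\<not> w (n, j) (n, Suc j)" using K_lt by (simp add: w_def)
    then show ?case using hV[of n j] Suc by blast
  qed
  have top: "h i n = h 0 n" for i
  proof (induction i)
    case (Suc j)
    have "\<not> w (j, n) (Suc j, n)" using K_lt by (simp add: w_def)
    then show ?case using hH[of j n] Suc by blast
  qed simp
  show False using right[of n] top[of n] y_axis[of n] by blast
qed


section \<open>Walks: counting, shortening and the union bound\<close>

fun walks :: "('b \<Rightarrow> 'b set) \<Rightarrow> 'b \<Rightarrow> nat \<Rightarrow> 'b list set" where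
  "walks nbrs k 0 = {[k]}"
| "walks nbrs k (Suc n) = (\<Union>j\<in>nbrs k. Cons k ` walks nbrs j n)"

lemma finite_walks: "(\<And>k. finite (nbrs k)) \<Longrightarrow> finite (walks nbrs k n)"
  by (induction n arbitrary: k) auto

lemma card_walks_le:
  assumes "\<And>k. finite (nbrs k)" "\<And>k. card (nbrs k) \<le> M"
  shows "card (walks nbrs k n) \<le> M ^ n"
proof (induction n arbitrary: k)
  case (Suc n)
  have "card (walks nbrs k (Suc n)) \<le> (\<Sum>j\<in>nbrs k. card (Cons k ` walks nbrs j n))"
    using assms by (simp add: card_UN_le)
  also have "\<dots> \<le> (\<Sum>j\<in>nbrs k. M ^ n)"
    using Suc finite_walks[of nbrs, OF assms(1)] by (intro sum_mono order_trans[OF card_image_le]) auto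
  also have "\<dots> \<le> M ^ Suc n"
    using assms(2)[of k] by simp
  finally show ?case .
qed simp

lemma length_walks: "l \<in> walks nbrs k n \<Longrightarrow> length l = Suc n"
  by (induction n arbitrary: k l) auto

lemma rtrancl_path_in_walks:
  assumes "rtrancl_path r x xs y" "\<And>u v. r u v \<Longrightarrow> v \<in> nbrs u"
  shows "x # xs \<in> walks nbrs x (length xs)"
  using assms(1) by induction (use assms(2) in auto)

lemma take_in_walks:
  "l \<in> walks nbrs k n \<Longrightarrow> m \<le> n \<Longrightarrow> take (Suc m) l \<in> walks nbrs k m"
proof (induction m arbitrary: l k n)
  case 0 then show ?case by (cases n) auto
next
  case (Suc m)
  then obtain n' where "n = Suc n'" by (cases n) auto
  with Suc show ?case by force
qed

lemma rtrancl_path_set: "rtrancl_path r x xs y \<Longrightarrow> (\<And>u v. r u v \<Longrightarrow> v \<in> C) \<Longrightarrow> set xs \<subseteq> C"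
  by (induction rule: rtrancl_path.induct) auto

text \<open>Paths can be freed of repetitions without changing their ends. If all repetition-free
  paths had fewer than \<open>n\<close> steps, finite branching would leave only finitely many ends;
  a longer one is cut after \<open>n\<close> steps.\<close>

lemma infinite_cluster_walk:
  assumes fin: "\<And>k. finite (nbrs k)" and inf: "infinite {y. r\<^sup>*\<^sup>* x y}"
    and r: "\<And>u v. r u v \<Longrightarrow> v \<in> nbrs u" "\<And>u v. r u v \<Longrightarrow> v \<in> C" and x: "x \<in> C"
  obtains l where "l \<in> walks nbrs x n" "distinct l" "set l \<subseteq> C"
proof -
  have ex: "\<exists>xs. rtrancl_path r x xs y \<and> distinct (x # xs)" if "r\<^sup>*\<^sup>* x y" for y
    using that unfolding rtranclp_eq_rtrancl_path by (metis rtrancl_path_distinct)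
  have last: "y = last (x # xs)" if "rtrancl_path r x xs y" for xs y
    using that by induction auto
  have "\<exists>xs y. rtrancl_path r x xs y \<and> distinct (x # xs) \<and> n \<le> length xs"
  proof (rule ccontr)
    assume none: "\<not> ?thesis"
    have "{y. r\<^sup>*\<^sup>* x y} \<subseteq> (\<Union>m<n. last ` walks nbrs x m)"
    proof
      fix y assume "y \<in> {y. r\<^sup>*\<^sup>* x y}"
      then obtain xs where xs: "rtrancl_path r x xs y" "distinct (x # xs)" using ex by auto
      then have "length xs < n" using none by (metis not_le)
      moreover have "x # xs \<in> walks nbrs x (length xs)"
        using rtrancl_path_in_walks[OF xs(1)] r(1) by blast
      ultimately show "y \<in> (\<Union>m<n. last ` walks nbrs x m)"
        using last[OF xs(1)] by blast
    qed
    moreover have "finite (\<Union>m<n. last ` walks nbrs x m)"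
      using finite_walks[of nbrs, OF fin] by blast
    ultimately show False using inf finite_subset by blast
  qed
  then obtain xs y where xs: "rtrancl_path r x xs y" "distinct (x # xs)" "n \<le> length xs" by blast
  show ?thesis
  proof (rule that)
    show "take (Suc n) (x # xs) \<in> walks nbrs x n"
      using rtrancl_path_in_walks[OF xs(1)] r(1) xs(3) by (blast intro: take_in_walks)
    show "distinct (take (Suc n) (x # xs))" using xs(2) by (rule distinct_take)
    have "set (x # xs) \<subseteq> C" using rtrancl_path_set[OF xs(1) r(2)] x by simp
    then show "set (take (Suc n) (x # xs)) \<subseteq> C" by (meson order_trans set_take_subset)
  qed
qed

text \<open>A king move lowers the first coordinate by at most 1.\<close>

lemma star_path_length:
  assumes "rtrancl_path (\<lambda>u v. v \<in> C \<and> v \<in> star_nbrs u) x xs y" "fst y = 0"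
  shows "fst x \<le> length xs"
  using assms by induction (auto simp: star_nbrs_def)

lemma finite_star_nbrs: "finite (star_nbrs u)"
  by (simp add: star_nbrs_def)

lemma card_star_nbrs: "card (star_nbrs u) \<le> 9"
proof -
  have "card {i - 1..i + 1} \<le> (3::nat)" for i :: nat by (cases i) auto
  then have "card (star_nbrs u) \<le> 3 * 3"
    unfolding star_nbrs_def card_cartesian_product by (intro mult_mono) auto
  then show ?thesis by simp
qed

text \<open>
  Starting at distance \<open>i\<close> from the second axis, the path has at least \<open>i\<close> steps; for \<open>i = 0\<close> the
  conclusion says that the corner itself lies in \<open>C\<close>.
\<close>

lemma finite_cluster_closed_walk:
  assumes "finite {v. (\<lambda>u v. adjacent u v \<and> v \<notin> C)\<^sup>*\<^sup>* (0, 0) v}"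
  obtains i l where "l \<in> walks star_nbrs (i, 0) i" "distinct l" "set l \<subseteq> C"
proof -
  let ?R = "\<lambda>u v. v \<in> C \<and> v \<in> star_nbrs u"
  let ?K = "{v. (\<lambda>u v. adjacent u v \<and> v \<notin> C)\<^sup>*\<^sup>* (0, 0) v}"
  have "v \<in> C" if "u \<in> ?K" "v \<notin> ?K" "adjacent u v" for u v
    using that by (auto intro: rtranclp.rtrancl_into_rtrancl)
  then obtain i j where ij: "(i, 0) \<in> C" "?R\<^sup>*\<^sup>* (i, 0) (0, j)"
    using separating_star_path[of ?K C] assms by blast
  then obtain xs where xs: "rtrancl_path ?R (i, 0) xs (0, j)" "distinct ((i, 0) # xs)"
    unfolding rtranclp_eq_rtrancl_path by (metis (no_types, lifting) rtrancl_path_distinct)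
  have "i \<le> length xs" using star_path_length[OF xs(1)] by simp
  show ?thesis
  proof (rule that)
    show "take (Suc i) ((i, 0) # xs) \<in> walks star_nbrs (i, 0) i"
      using rtrancl_path_in_walks[OF xs(1)] \<open>i \<le> length xs\<close> by (blast intro: take_in_walks)
    show "distinct (take (Suc i) ((i, 0) # xs))" using xs(2) by (rule distinct_take)
    have "set ((i, 0) # xs) \<subseteq> C" using rtrancl_path_set[OF xs(1), of C] ij(1) by simp
    then show "set (take (Suc i) ((i, 0) # xs)) \<subseteq> C" by (meson order_trans set_take_subset)
  qed
qed

lemma measure_walks_le:
  assumes "finite_measure M" and fin: "\<And>k. finite (nbrs k)" "\<And>k. card (nbrs k) \<le> N"
    and A: "\<And>l. l \<in> walks nbrs k n \<Longrightarrow> distinct l \<Longrightarrow> A l \<in> sets M \<and> measure M (A l) \<le> b"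
    and b: "0 \<le> b"
  shows "(\<Union>l\<in>{l \<in> walks nbrs k n. distinct l}. A l) \<in> sets M"
    "measure M (\<Union>l\<in>{l \<in> walks nbrs k n. distinct l}. A l) \<le> real N ^ n * b"
proof -
  interpret finite_measure M by fact
  let ?W = "{l \<in> walks nbrs k n. distinct l}"
  have finW: "finite ?W" using finite_walks[of nbrs k n, OF fin(1)] by simp
  show "(\<Union>l\<in>?W. A l) \<in> sets M" using finW A by (intro sets.finite_UN) auto
  have "measure M (\<Union>l\<in>?W. A l) \<le> (\<Sum>l\<in>?W. measure M (A l))"
    using finW A by (intro measure_UNION_le) auto
  also have "\<dots> \<le> real (card ?W) * b" using A by (intro sum_bounded_above) auto
  also have "\<dots> \<le> real N ^ n * b"
  proof (rule mult_right_mono[OF _ b])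
    have "card ?W \<le> card (walks nbrs k n)"
      using finite_walks[of nbrs k n, OF fin(1)] by (intro card_mono) auto
    also have "\<dots> \<le> N ^ n" by (rule card_walks_le[OF fin])
    finally show "real (card ?W) \<le> real N ^ n" by (metis of_nat_le_iff of_nat_power)
  qed
  finally show "measure M (\<Union>l\<in>?W. A l) \<le> real N ^ n * b" .
qed

section \<open>Comparison of counts with Poisson counts\<close>

lemma point_processD:
  assumes "point_process \<Phi>"
  shows "prob_space \<Phi>" "sets \<Phi> = sets configuration_space" "space \<Phi> = configurations"
  using assms sets_eq_imp_space_eq[of \<Phi> configuration_space] by (auto simp: point_process_def)

lemma point_process_count_measurable:
  assumes "point_process \<Phi>" "B \<in> bounded_borel"
  shows "(\<lambda>\<mu>. emeasure \<mu> B) \<in> borel_measurable \<Phi>" "(\<lambda>\<mu>. measure \<mu> B) \<in> borel_measurable \<Phi>"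
  using measurable_count[OF assms(2)] measurable_measure_count[OF assms(2)]
    measurable_cong_sets[OF point_processD(2)[OF assms(1)] refl] by auto

text \<open>Counts take countably many values, so \<open>P\<close> may be an arbitrary
  predicate.\<close>

lemma count_event_sets:
  assumes "point_process \<Phi>" "B \<in> bounded_borel"
  shows "{\<mu> \<in> space \<Phi>. P (emeasure \<mu> B)} \<in> sets \<Phi>"
proof -
  note [measurable] = point_process_count_measurable(1)[OF assms]
  have "{\<mu> \<in> space \<Phi>. P (emeasure \<mu> B)} =
    (\<Union>k\<in>{k::nat. P (of_nat k)}. {\<mu> \<in> space \<Phi>. emeasure \<mu> B = of_nat k})"
    using configuration_count[OF _ assms(2)] point_processD(3)[OF assms(1)] by (auto; metis)
  also have "\<dots> \<in> sets \<Phi>" by measurable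
  finally show ?thesis .
qed

text \<open>The law of one count is isolated because the dominating process arises in two ways: as a
  homogeneous Poisson process, or as the unspecified one of \<open>dcx_sub_poisson\<close>, whose
  parameter is identified only afterwards.\<close>

definition poisson_count :: "'a::euclidean_space measure measure \<Rightarrow> 'a set \<Rightarrow> real \<Rightarrow> bool" where
  "poisson_count \<Psi> B t \<longleftrightarrow>
     (\<forall>k::nat. measure \<Psi> {\<mu> \<in> space \<Psi>. emeasure \<mu> B = of_nat k} = t ^ k / fact k * exp (- t))"

lemma nn_integral_poisson_count:
  assumes \<Psi>: "point_process \<Psi>" and B: "B \<in> bounded_borel" and poi: "poisson_count \<Psi> B t"
  shows "(\<integral>\<^sup>+ \<mu>. ennreal (f (measure \<mu> B)) \<partial>\<Psi>) =
    (\<Sum>k. ennreal (f (real k)) * ennreal (t ^ k / fact k * exp (- t)))"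
proof -
  interpret prob_space \<Psi> using point_processD(1)[OF \<Psi>] .
  let ?A = "\<lambda>k::nat. {\<mu> \<in> space \<Psi>. emeasure \<mu> B = of_nat k}"
  have A: "?A k \<in> sets \<Psi>" for k by (rule count_event_sets[OF \<Psi> B])
  have "(\<integral>\<^sup>+ \<mu>. ennreal (f (measure \<mu> B)) \<partial>\<Psi>) = (\<integral>\<^sup>+ \<mu>. (\<Sum>k. ennreal (f (real k)) * indicator (?A k) \<mu>) \<partial>\<Psi>)"
  proof (rule nn_integral_cong)
    fix \<mu> assume \<mu>: "\<mu> \<in> space \<Psi>"
    then obtain k :: nat where k: "emeasure \<mu> B = of_nat k" "measure \<mu> B = real k"
      using configuration_count[OF _ B] point_processD(3)[OF \<Psi>] by metis
    have "(\<Sum>j. ennreal (f (real j)) * indicator (?A j) \<mu>) = (\<Sum>j\<in>{k}. ennreal (f (real j)) * indicator (?A j) \<mu>)"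
      by (rule suminf_finite) (use k in auto)
    also have "\<dots> = ennreal (f (measure \<mu> B))" using k \<mu> by simp
    finally show "ennreal (f (measure \<mu> B)) = (\<Sum>j. ennreal (f (real j)) * indicator (?A j) \<mu>)" ..
  qed
  also have "\<dots> = (\<Sum>k. \<integral>\<^sup>+ \<mu>. ennreal (f (real k)) * indicator (?A k) \<mu> \<partial>\<Psi>)"
    using A by (intro nn_integral_suminf borel_measurable_times_ennreal borel_measurable_indicator borel_measurable_const)
  also have "\<dots> = (\<Sum>k. ennreal (f (real k)) * ennreal (t ^ k / fact k * exp (- t)))"
  proof (rule suminf_cong)
    fix k
    have "measure \<Psi> (?A k) = t ^ k / fact k * exp (- t)"
      using poi unfolding poisson_count_def by blast
    then show "(\<integral>\<^sup>+ \<mu>. ennreal (f (real k)) * indicator (?A k) \<mu> \<partial>\<Psi>) =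
        ennreal (f (real k)) * ennreal (t ^ k / fact k * exp (- t))"
      using nn_integral_cmult_indicator[OF A] emeasure_eq_measure[of "?A k"] by metis
  qed
  finally show ?thesis .
qed

text \<open>The condition on \<open>a\<close> serves
  \<open>k - m \<le> 2 ^ (k - m) \<le> a ^ (k - m)\<close> for \<open>m \<le> k\<close>; the mean of
  \<open>a ^ k\<close> under the Poisson law is \<open>exp (t * (a - 1))\<close>.\<close>

lemma poisson_truncated_mean_le:
  assumes \<Psi>: "point_process \<Psi>" "B \<in> bounded_borel" "poisson_count \<Psi> B t" and t: "0 \<le> t" and a: "2 \<le> a"
  shows "(\<integral>\<^sup>+ \<mu>. ennreal (max 0 (measure \<mu> B - real m)) \<partial>\<Psi>) \<le> ennreal (exp (t * (a - 1)) / a ^ m)"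
proof -
  let ?p = "\<lambda>k. t ^ k / fact k * exp (- t)"
  have le: "max 0 (real k - real m) \<le> a ^ k / a ^ m" for k
  proof (cases "m \<le> k")
    case True
    then have "max 0 (real k - real m) = real (k - m)" by simp
    also have "\<dots> \<le> 2 ^ (k - m)" using of_nat_less_two_power[of "k - m", where 'a=real] by simp
    also have "\<dots> \<le> a ^ (k - m)" using a by (intro power_mono) auto
    also have "\<dots> = a ^ k / a ^ m" using a True by (simp add: power_diff)
    finally show ?thesis .
  qed (use a in auto)
  have sums: "(\<lambda>k. (a ^ k / a ^ m) * ?p k) sums (exp (t * (a - 1)) / a ^ m)"
  proof -
    have "(\<lambda>k. (exp (- t) / a ^ m) * ((a * t) ^ k /\<^sub>R fact k)) sums ((exp (- t) / a ^ m) * exp (a * t))"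
      by (intro sums_mult exp_converges)
    then show ?thesis
      by (simp add: power_mult_distrib field_simps exp_minus exp_diff)
  qed
  have "(\<integral>\<^sup>+ \<mu>. ennreal (max 0 (measure \<mu> B - real m)) \<partial>\<Psi>) =
      (\<Sum>k. ennreal (max 0 (real k - real m)) * ennreal (?p k))"
    by (rule nn_integral_poisson_count[OF \<Psi>, of "\<lambda>x. max 0 (x - real m)"])
  also have "\<dots> = (\<Sum>k. ennreal (max 0 (real k - real m) * ?p k))"
    using t by (intro suminf_cong ennreal_mult[symmetric]) auto
  also have "\<dots> \<le> (\<Sum>k. ennreal ((a ^ k / a ^ m) * ?p k))"
    using t le by (intro suminf_le ennreal_leI mult_right_mono) auto
  also have "\<dots> = ennreal (exp (t * (a - 1)) / a ^ m)"
    using t a sums by (intro suminf_ennreal_eq) auto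
  finally show ?thesis .
qed

lemma poisson_mean:
  assumes \<Psi>: "point_process \<Psi>" "B \<in> bounded_borel" "poisson_count \<Psi> B t" and t: "0 \<le> t"
  shows "(\<integral>\<^sup>+ \<mu>. ennreal (measure \<mu> B) \<partial>\<Psi>) = ennreal t"
proof -
  let ?p = "\<lambda>k. t ^ k / fact k * exp (- t)"
  have "(\<lambda>k. (exp (- t) * t) * (t ^ k /\<^sub>R fact k)) sums ((exp (- t) * t) * exp t)"
    by (intro sums_mult exp_converges)
  moreover have "(exp (- t) * t) * exp t = t" by (simp add: exp_minus)
  moreover have "(exp (- t) * t) * (t ^ k /\<^sub>R fact k) = real (Suc k) * ?p (Suc k)" for k
    by (simp add: divide_simps del: of_nat_Suc)
  ultimately have "(\<lambda>k. real (Suc k) * ?p (Suc k)) sums t" by simp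
  then have "(\<lambda>k. real k * ?p k) sums t" by (subst (asm) sums_Suc_iff) simp
  then have "(\<Sum>k. ennreal (real k * ?p k)) = ennreal t"
    using t by (intro suminf_ennreal_eq) auto
  moreover have "(\<Sum>k. ennreal (real k) * ennreal (?p k)) = (\<Sum>k. ennreal (real k * ?p k))"
    using t by (intro suminf_cong ennreal_mult[symmetric]) auto
  ultimately show ?thesis
    using nn_integral_poisson_count[OF \<Psi>, of "\<lambda>x. x"] by metis
qed

lemma integrable_count_iff:
  assumes \<Phi>: "point_process \<Phi>" and B: "B \<in> bounded_borel"
  shows "integrable \<Phi> (\<lambda>\<mu>. measure \<mu> B) \<longleftrightarrow> mean_measure \<Phi> B < \<infinity>"
    and "mean_measure \<Phi> B = (\<integral>\<^sup>+ \<mu>. ennreal (measure \<mu> B) \<partial>\<Phi>)"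
proof -
  show eq: "mean_measure \<Phi> B = (\<integral>\<^sup>+ \<mu>. ennreal (measure \<mu> B) \<partial>\<Phi>)"
    unfolding mean_measure_def
  proof (rule nn_integral_cong)
    fix \<mu> assume "\<mu> \<in> space \<Phi>"
    then obtain k :: nat where "emeasure \<mu> B = of_nat k" "measure \<mu> B = real k"
      using configuration_count[OF _ B] point_processD(3)[OF \<Phi>] by metis
    then show "emeasure \<mu> B = ennreal (measure \<mu> B)" by (simp add: ennreal_of_nat_eq_real_of_nat)
  qed
  show "integrable \<Phi> (\<lambda>\<mu>. measure \<mu> B) \<longleftrightarrow> mean_measure \<Phi> B < \<infinity>"
    unfolding eq using point_process_count_measurable(2)[OF assms] by (simp add: integrable_iff_bounded)
qed

section \<open>Consequences of the orders for one count\<close>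

lemma process_le_single:
  assumes "process_le F \<Phi> \<Psi>" "B \<in> bounded_borel" "(\<lambda>x. g (x 0)) \<in> F 1"
    "integrable \<Phi> (\<lambda>\<mu>. g (measure \<mu> B))" "integrable \<Psi> (\<lambda>\<mu>. g (measure \<mu> B))"
  shows "(\<integral> \<mu>. g (measure \<mu> B) \<partial>\<Phi>) \<le> (\<integral> \<mu>. g (measure \<mu> B) \<partial>\<Psi>)"
proof -
  have "vector_le (F 1) \<Phi> (counts 1 (\<lambda>_. B)) \<Psi> (counts 1 (\<lambda>_. B))"
    using assms(1,2) by (simp add: process_le_def)
  then show ?thesis
    using assms(3-5) unfolding vector_le_def by (fastforce simp: counts_def)
qed

lemma dcx_1I:
  assumes "\<And>x y p q :: real. p \<le> x \<Longrightarrow> x \<le> q \<Longrightarrow> p \<le> y \<Longrightarrow> y \<le> q \<Longrightarrow> x + y = p + q \<Longrightarrow> g x + g y \<le> g p + g q"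
  shows "(\<lambda>x. g (x 0)) \<in> dcx 1"
  using assms unfolding dcx_def by simp

text \<open>A count above \<open>m\<close> is at least \<open>m + 1\<close>, where the test function
  is at least 1. The finite mean makes this function integrable under \<Phi>, so that the order
  applies to it.\<close>

lemma prob_count_ge_le:
  assumes \<Phi>: "point_process \<Phi>" and \<Psi>: "point_process \<Psi>" and B: "B \<in> bounded_borel"
    and poi: "poisson_count \<Psi> B t" and t: "0 \<le> t" and a: "2 \<le> a"
    and le: "process_le idcx \<Phi> \<Psi>" and fin: "mean_measure \<Phi> B < \<infinity>"
  shows "measure \<Phi> {\<mu> \<in> space \<Phi>. of_nat (Suc m) \<le> emeasure \<mu> B} \<le> exp (t * (a - 1)) / a ^ m"
proof -
  interpret \<Phi>: prob_space \<Phi> using point_processD(1)[OF \<Phi>] .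
  let ?g = "\<lambda>x. max 0 (x - real m)"
  let ?A = "{\<mu> \<in> space \<Phi>. of_nat (Suc m) \<le> emeasure \<mu> B}"
  have A: "?A \<in> sets \<Phi>" by (rule count_event_sets[OF \<Phi> B])
  note meas = point_process_count_measurable(2)[OF _ B]
  have g: "(\<lambda>x. ?g (x 0)) \<in> idcx 1"
    unfolding idcx_def using dcx_1I[of ?g] by (auto simp: max_def)
  have int\<Phi>: "integrable \<Phi> (\<lambda>\<mu>. ?g (measure \<mu> B))"
    by (rule Bochner_Integration.integrable_bound[of _ "\<lambda>\<mu>. measure \<mu> B"])
      (use integrable_count_iff(1)[OF \<Phi> B] fin meas[OF \<Phi>] in \<open>auto simp: max_def\<close>)
  have nn: "(\<integral>\<^sup>+ \<mu>. ennreal (?g (measure \<mu> B)) \<partial>\<Psi>) \<le> ennreal (exp (t * (a - 1)) / a ^ m)"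
    by (rule poisson_truncated_mean_le[OF \<Psi> B poi t a])
  then have int\<Psi>: "integrable \<Psi> (\<lambda>\<mu>. ?g (measure \<mu> B))"
    using meas[OF \<Psi>] by (intro integrableI_nonneg) (auto intro: le_less_trans)
  have "measure \<Phi> ?A = (\<integral> \<mu>. indicator ?A \<mu> \<partial>\<Phi>)" using A by simp
  also have "\<dots> \<le> (\<integral> \<mu>. ?g (measure \<mu> B) \<partial>\<Phi>)"
  proof (rule integral_mono)
    fix \<mu> assume "\<mu> \<in> space \<Phi>"
    then obtain k :: nat where k: "emeasure \<mu> B = of_nat k" "measure \<mu> B = real k"
      using configuration_count[OF _ B] point_processD(3)[OF \<Phi>] by metis
    have "real m + 1 \<le> real k" if "of_nat (Suc m) \<le> (of_nat k :: ennreal)"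
      using that unfolding of_nat_le_iff by simp
    then show "indicator ?A \<mu> \<le> ?g (measure \<mu> B)"
      using k by (auto simp: indicator_def simp del: of_nat_Suc)
  next
    show "integrable \<Phi> (indicator ?A :: _ \<Rightarrow> real)"
      by (rule integrable_real_indicator[OF A])
        (simp only: \<Phi>.emeasure_eq_measure ennreal_less_top infinity_ennreal_def)
  qed (rule int\<Phi>)
  also have "\<dots> \<le> (\<integral> \<mu>. ?g (measure \<mu> B) \<partial>\<Psi>)"
    by (rule process_le_single[OF le B g int\<Phi> int\<Psi>])
  also have "\<dots> \<le> exp (t * (a - 1)) / a ^ m"
  proof -
    have "ennreal (\<integral> \<mu>. ?g (measure \<mu> B) \<partial>\<Psi>) \<le> ennreal (exp (t * (a - 1)) / a ^ m)"
      using nn nn_integral_eq_integral[OF int\<Psi>] by simp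
    then show ?thesis using a by (subst (asm) ennreal_le_iff) auto
  qed
  finally show ?thesis .
qed

text \<open>On the natural numbers the test function is exactly the indicator of 0, hence bounded,
  so its integrability comes for free.\<close>

lemma prob_void_le:
  assumes \<Phi>: "point_process \<Phi>" and \<Psi>: "point_process \<Psi>" and B: "B \<in> bounded_borel"
    and poi: "poisson_count \<Psi> B t" and le: "process_le ddcx \<Phi> \<Psi>"
  shows "measure \<Phi> {\<mu> \<in> space \<Phi>. emeasure \<mu> B = 0} \<le> exp (- t)"
proof -
  let ?g = "\<lambda>x. max 0 (1 - x :: real)"
  have g: "(\<lambda>x. ?g (x 0)) \<in> ddcx 1"
    unfolding ddcx_def using dcx_1I[of ?g] by (auto simp: max_def)
  have *: "integrable \<Theta> (\<lambda>\<mu>. ?g (measure \<mu> B))"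
    "(\<integral> \<mu>. ?g (measure \<mu> B) \<partial>\<Theta>) = measure \<Theta> {\<mu> \<in> space \<Theta>. emeasure \<mu> B = 0}"
    if \<Theta>: "point_process \<Theta>" for \<Theta>
  proof -
    interpret prob_space \<Theta> using point_processD(1)[OF \<Theta>] .
    let ?A = "{\<mu> \<in> space \<Theta>. emeasure \<mu> B = 0}"
    have A: "?A \<in> sets \<Theta>" by (rule count_event_sets[OF \<Theta> B])
    have eq: "?g (measure \<mu> B) = indicator ?A \<mu>" if "\<mu> \<in> space \<Theta>" for \<mu>
    proof -
      obtain k :: nat where "emeasure \<mu> B = of_nat k" "measure \<mu> B = real k"
        using configuration_count[OF _ B] point_processD(3)[OF \<Theta>] \<open>\<mu> \<in> space \<Theta>\<close> by metis
      then show ?thesis using \<open>\<mu> \<in> space \<Theta>\<close> by (cases k) auto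
    qed
    have "integrable \<Theta> (\<lambda>\<mu>. ?g (measure \<mu> B)) \<longleftrightarrow> integrable \<Theta> (indicator ?A :: _ \<Rightarrow> real)"
      by (rule Bochner_Integration.integrable_cong[OF refl eq])
    moreover have "integrable \<Theta> (indicator ?A :: _ \<Rightarrow> real)"
      by (rule integrable_real_indicator[OF A])
        (simp only: emeasure_eq_measure ennreal_less_top infinity_ennreal_def)
    ultimately show "integrable \<Theta> (\<lambda>\<mu>. ?g (measure \<mu> B))" by blast
    have "(\<integral> \<mu>. ?g (measure \<mu> B) \<partial>\<Theta>) = (\<integral> \<mu>. indicator ?A \<mu> \<partial>\<Theta>)"
      by (rule Bochner_Integration.integral_cong[OF refl eq])
    then show "(\<integral> \<mu>. ?g (measure \<mu> B) \<partial>\<Theta>) = measure \<Theta> ?A" using A by simp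
  qed
  have "measure \<Psi> {\<mu> \<in> space \<Psi>. emeasure \<mu> B = of_nat 0} = exp (- t)"
    using poi unfolding poisson_count_def by (metis div_by_1 fact_0 mult_1 power_0)
  then show ?thesis
    using process_le_single[OF le B g *(1)[OF \<Phi>] *(1)[OF \<Psi>]] *(2)[OF \<Phi>] *(2)[OF \<Psi>] by simp
qed

text \<open>The identity and its negative are both directionally convex, so the order forces equal
  means.\<close>

lemma sub_poisson_mean_eq:
  assumes \<Phi>: "point_process \<Phi>" and \<Psi>: "point_process \<Psi>" and B: "B \<in> bounded_borel"
    and poi: "poisson_count \<Psi> B t" and t: "0 \<le> t"
    and le: "process_le dcx \<Phi> \<Psi>" and mean: "mean_measure \<Phi> B = ennreal u" "0 \<le> u"
  shows "t = u"
proof -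
  have mean\<Psi>: "mean_measure \<Psi> B = ennreal t"
    using poisson_mean[OF \<Psi> B poi t] integrable_count_iff(2)[OF \<Psi> B] by simp
  have int: "integrable \<Phi> (\<lambda>\<mu>. measure \<mu> B)" "integrable \<Psi> (\<lambda>\<mu>. measure \<mu> B)"
    using integrable_count_iff(1)[OF \<Phi> B] integrable_count_iff(1)[OF \<Psi> B] mean mean\<Psi> by auto
  have dcx: "(\<lambda>x. x 0) \<in> dcx 1" "(\<lambda>x. - x 0) \<in> dcx 1"
    using dcx_1I[of "\<lambda>x. x"] dcx_1I[of uminus] by auto
  have "(\<integral> \<mu>. measure \<mu> B \<partial>\<Phi>) = u"
    using nn_integral_eq_integral[OF int(1)] mean integrable_count_iff(2)[OF \<Phi> B] by simp
  moreover have "(\<integral> \<mu>. measure \<mu> B \<partial>\<Psi>) = t"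
    using nn_integral_eq_integral[OF int(2)] mean\<Psi> t integrable_count_iff(2)[OF \<Psi> B] by simp
  ultimately show ?thesis
    using process_le_single[OF le B dcx(1) int] process_le_single[OF le B dcx(2)] int by simp
qed

text \<open>Counts of occupied cells are at least 1, so their product dominates the indicator of the
  event, and its mean is an integral of the joint intensity over the product of the cells.\<close>

lemma weakly_sub_poisson_occupied_le:
  fixes B :: "nat \<Rightarrow> 'a::euclidean_space set"
  assumes \<Phi>: "point_process \<Phi>" and weak: "weakly_sub_poisson lam \<Phi>" and lam: "0 \<le> lam"
    and B: "\<And>i. i < n \<Longrightarrow> B i \<in> bounded_borel" "disjoint_family_on B {..<n}"
    and vol: "\<And>i. i < n \<Longrightarrow> emeasure lborel (B i) \<le> ennreal v" and v: "0 \<le> v" and n: "1 \<le> n"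
  shows "measure \<Phi> {\<mu> \<in> space \<Phi>. \<forall>i<n. emeasure \<mu> (B i) \<noteq> 0} \<le> (lam * v) ^ n"
proof -
  interpret prob_space \<Phi> using point_processD(1)[OF \<Phi>] .
  interpret L: product_sigma_finite "\<lambda>_::nat. lborel :: 'a measure" ..
  obtain \<rho> where \<rho>: "joint_intensity \<Phi> n \<rho>" "AE x in (\<Pi>\<^sub>M i\<in>{..<n}. lborel). \<rho> x \<le> lam ^ n"
    using weak n unfolding weakly_sub_poisson_def by blast
  let ?A = "{\<mu> \<in> space \<Phi>. \<forall>i<n. emeasure \<mu> (B i) \<noteq> 0}"
  have "?A = space \<Phi> \<inter> (\<Inter>i\<in>{..<n}. {\<mu> \<in> space \<Phi>. emeasure \<mu> (B i) \<noteq> 0})" by auto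
  also have "\<dots> \<in> sets \<Phi>"
    using n by (intro sets.Int sets.finite_INT count_event_sets[OF \<Phi>] B(1)) (auto simp: lessThan_empty_iff bot_nat_def)
  finally have A: "?A \<in> sets \<Phi>" .
  have "emeasure \<Phi> ?A = (\<integral>\<^sup>+ \<mu>. indicator ?A \<mu> \<partial>\<Phi>)"
    by (rule nn_integral_indicator[OF A, symmetric])
  also have "\<dots> \<le> (\<integral>\<^sup>+ \<mu>. (\<Prod>i<n. emeasure \<mu> (B i)) \<partial>\<Phi>)"
  proof (rule nn_integral_mono)
    fix \<mu> assume \<mu>: "\<mu> \<in> space \<Phi>"
    have "1 \<le> (\<Prod>i<n. emeasure \<mu> (B i))" if "\<mu> \<in> ?A"
      using that B(1) configuration_ge_1[of \<mu>] point_processD(3)[OF \<Phi>] by (intro prod_ge_1) auto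
    then show "indicator ?A \<mu> \<le> (\<Prod>i<n. emeasure \<mu> (B i))" by (auto simp: indicator_def)
  qed
  also have "\<dots> = (\<integral>\<^sup>+ x\<in>Pi\<^sub>E {..<n} B. ennreal (\<rho> x) \<partial>(\<Pi>\<^sub>M i\<in>{..<n}. lborel))"
    using \<rho>(1) B unfolding joint_intensity_def by blast
  also have "\<dots> \<le> (\<integral>\<^sup>+ x. ennreal (lam ^ n) * indicator (Pi\<^sub>E {..<n} B) x \<partial>(\<Pi>\<^sub>M i\<in>{..<n}. lborel))"
    using \<rho>(2) by (intro nn_integral_mono_AE) (auto elim!: eventually_mono intro!: mult_right_mono ennreal_leI)
  also have "\<dots> = ennreal (lam ^ n) * emeasure (\<Pi>\<^sub>M i\<in>{..<n}. lborel) (Pi\<^sub>E {..<n} B)"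
    using B(1) by (intro nn_integral_cmult_indicator sets_PiM_I_finite) (auto simp: bounded_borel_def)
  also have "\<dots> = ennreal (lam ^ n) * (\<Prod>i<n. emeasure lborel (B i))"
    using B(1) by (subst L.emeasure_PiM) (auto simp: bounded_borel_def)
  also have "\<dots> \<le> ennreal (lam ^ n) * ennreal v ^ n"
  proof (rule mult_left_mono)
    have "(\<Prod>i<m. emeasure lborel (B i)) \<le> ennreal v ^ m" if "m \<le> n" for m
      using that
    proof (induction m)
      case (Suc m)
      then have "(\<Prod>i<m. emeasure lborel (B i)) * emeasure lborel (B m) \<le> ennreal v ^ m * ennreal v"
        using vol[of m] by (intro mult_mono) auto
      then show ?case by (simp add: mult.commute)
    qed simp
    then show "(\<Prod>i<n. emeasure lborel (B i)) \<le> ennreal v ^ n" by simp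
  qed simp
  also have "\<dots> = ennreal ((lam * v) ^ n)"
    using lam v by (simp add: ennreal_power ennreal_mult[symmetric] power_mult_distrib)
  finally show ?thesis
    unfolding emeasure_eq_measure using lam v by (subst (asm) ennreal_le_iff) auto
qed

section \<open>The lower bound\<close>

text \<open>Cells are labelled by integer vectors of the space itself, so that the neighbours of
  every label are its translates by one finite set.\<close>

definition grid_index :: "real \<Rightarrow> 'a::euclidean_space \<Rightarrow> 'a" where
  "grid_index s x = (\<Sum>b\<in>Basis. of_int \<lfloor>x \<bullet> b / s\<rfloor> *\<^sub>R b)"

definition grid_cell :: "real \<Rightarrow> 'a::euclidean_space \<Rightarrow> 'a set" where
  "grid_cell s k = {x. grid_index s x = k}"

text \<open>The cardinality of this set bounds the branching of grid walks. It depends on the space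
  alone, as the constants must.\<close>

definition grid_steps :: "'a::euclidean_space set" where
  "grid_steps = (\<lambda>f. \<Sum>b\<in>Basis. of_int (f b) *\<^sub>R b) ` (Basis \<rightarrow>\<^sub>E {-1, 0, 1})"

definition grid_nbrs :: "'a::euclidean_space \<Rightarrow> 'a set" where
  "grid_nbrs k = (+) k ` grid_steps"

lemma finite_grid_steps: "finite (grid_steps :: 'a::euclidean_space set)"
  unfolding grid_steps_def by (intro finite_imageI finite_PiE) auto

lemma finite_grid_nbrs: "finite (grid_nbrs k)"
  unfolding grid_nbrs_def by (intro finite_imageI finite_grid_steps)

lemma card_grid_nbrs: "card (grid_nbrs (k::'a::euclidean_space)) \<le> card (grid_steps :: 'a set)"
  unfolding grid_nbrs_def using finite_grid_steps by (rule card_image_le)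

text \<open>An unbounded cluster may start in any cell; with countably many cells, a null event for
  each start remains null in the union.\<close>

lemma countable_range_grid_index: "countable (range (grid_index s :: 'a::euclidean_space \<Rightarrow> 'a))"
proof -
  have "range (grid_index s :: 'a \<Rightarrow> 'a) \<subseteq>
      (\<lambda>f. \<Sum>b\<in>Basis. of_int (f b) *\<^sub>R b) ` (Basis \<rightarrow>\<^sub>E (UNIV :: int set))"
  proof
    fix k :: 'a assume "k \<in> range (grid_index s)"
    then obtain x where "k = grid_index s x" by blast
    then have "k = (\<Sum>b\<in>Basis. of_int ((\<lambda>b\<in>Basis. \<lfloor>x \<bullet> b / s\<rfloor>) b) *\<^sub>R b)"
      unfolding grid_index_def by (auto intro!: sum.cong)
    then show "k \<in> (\<lambda>f. \<Sum>b\<in>Basis. of_int (f b) *\<^sub>R b) ` (Basis \<rightarrow>\<^sub>E (UNIV :: int set))"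
      by (intro image_eqI[where x="\<lambda>b\<in>Basis. \<lfloor>x \<bullet> b / s\<rfloor>"]) auto
  qed
  moreover have "countable (Basis \<rightarrow>\<^sub>E (UNIV :: int set) :: ('a \<Rightarrow> int) set)"
    by (intro countable_PiE) auto
  ultimately show ?thesis by (meson countable_image countable_subset)
qed

text \<open>After division by \<open>s\<close> the coordinates differ by at most 1, and then so do
  their floors.\<close>

lemma grid_index_step:
  fixes x y :: "'a::euclidean_space"
  assumes s: "0 < s" and d: "dist x y \<le> s"
  shows "grid_index s y \<in> grid_nbrs (grid_index s x)"
proof -
  let ?f = "\<lambda>b\<in>Basis. \<lfloor>y \<bullet> b / s\<rfloor> - \<lfloor>x \<bullet> b / s\<rfloor>"
  have "?f \<in> Basis \<rightarrow>\<^sub>E {-1, 0, 1}"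
  proof (rule PiE_I)
    fix b :: 'a assume b: "b \<in> Basis"
    have "\<bar>y \<bullet> b - x \<bullet> b\<bar> \<le> s"
      using d Basis_le_norm[OF b, of "y - x"] by (simp add: dist_norm norm_minus_commute inner_diff_left)
    then have "\<bar>y \<bullet> b / s - x \<bullet> b / s\<bar> \<le> 1"
      using s by (simp add: diff_divide_distrib[symmetric])
    then have "\<lfloor>y \<bullet> b / s\<rfloor> - \<lfloor>x \<bullet> b / s\<rfloor> \<in> {-1, 0, 1}"
      by (simp add: abs_le_iff) linarith
    then show "?f b \<in> {-1, 0, 1}" using b by simp
  qed auto
  moreover have "grid_index s y = grid_index s x + (\<Sum>b\<in>Basis. of_int (?f b) *\<^sub>R b)"
    unfolding grid_index_def by (simp add: sum.distrib[symmetric] algebra_simps)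
  ultimately show ?thesis unfolding grid_nbrs_def grid_steps_def by blast
qed

lemma grid_cell_subset_cbox:
  fixes k :: "'a::euclidean_space"
  assumes s: "0 < s"
  shows "grid_cell s k \<subseteq> cbox (s *\<^sub>R k) (s *\<^sub>R k + s *\<^sub>R One)"
proof
  fix x assume "x \<in> grid_cell s k"
  then have k: "k \<bullet> b = of_int \<lfloor>x \<bullet> b / s\<rfloor>" if "b \<in> Basis" for b
    using that by (auto simp: grid_cell_def grid_index_def inner_sum_left inner_Basis if_distrib cong: if_cong)
  have "s * (k \<bullet> b) \<le> x \<bullet> b \<and> x \<bullet> b \<le> s * (k \<bullet> b) + s" if "b \<in> Basis" for b
  proof -
    have "of_int \<lfloor>x \<bullet> b / s\<rfloor> * s \<le> x \<bullet> b"
      using of_int_floor_le[of "x \<bullet> b / s"] unfolding pos_le_divide_eq[OF s] .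
    moreover have "x \<bullet> b \<le> (of_int \<lfloor>x \<bullet> b / s\<rfloor> + 1) * s"
      using real_of_int_floor_add_one_ge[of "x \<bullet> b / s"] unfolding pos_divide_le_eq[OF s] .
    ultimately show ?thesis using k[OF that] by (simp add: algebra_simps)
  qed
  then show "x \<in> cbox (s *\<^sub>R k) (s *\<^sub>R k + s *\<^sub>R One)"
    by (auto simp: mem_box inner_add_left)
qed

lemma grid_cell_bounded_borel:
  fixes k :: "'a::euclidean_space"
  assumes s: "0 < s"
  shows "grid_cell s k \<in> bounded_borel"
proof (rule bounded_borelI)
  have "grid_index s \<in> borel_measurable (borel :: 'a measure)"
    unfolding grid_index_def by measurable
  then have "grid_index s -` {k} \<inter> space borel \<in> sets (borel :: 'a measure)"
    by (rule measurable_sets) simp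
  then show "grid_cell s k \<in> sets borel" by (simp add: grid_cell_def vimage_def)
  show "bounded (grid_cell s k)" by (rule bounded_subset[OF bounded_cbox grid_cell_subset_cbox[OF s]])
qed

lemma emeasure_grid_cell_le:
  fixes k :: "'a::euclidean_space"
  assumes s: "0 < s"
  shows "emeasure lborel (grid_cell s k) \<le> ennreal (s ^ DIM('a))"
proof -
  have "emeasure lborel (grid_cell s k) \<le> emeasure lborel (cbox (s *\<^sub>R k) (s *\<^sub>R k + s *\<^sub>R One))"
    by (rule emeasure_mono[OF grid_cell_subset_cbox[OF s]]) simp
  also have "\<dots> = ennreal (s ^ DIM('a))"
    using s by (subst emeasure_lborel_cbox) (auto simp: inner_add_left)
  finally show ?thesis .
qed

lemma disjoint_grid_cells: "j \<noteq> k \<Longrightarrow> grid_cell s j \<inter> grid_cell s k = {}"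
  by (auto simp: grid_cell_def)

text \<open>Finitely many cells cover only a bounded set, so an unbounded cluster visits infinitely
  many; links project to grid steps between occupied cells because
  \<open>2 * r \<le> s\<close>.\<close>

lemma unbounded_cluster_grid_walk:
  fixes \<mu> :: "'a::euclidean_space measure"
  assumes \<mu>: "\<mu> \<in> configurations" and s: "0 < s" "2 * r \<le> s"
    and x: "x \<in> points \<mu>" "\<not> bounded (cluster \<mu> r x)"
  obtains l where "l \<in> walks grid_nbrs (grid_index s x) n" "distinct l"
    "\<And>k. k \<in> set l \<Longrightarrow> emeasure \<mu> (grid_cell s k) \<noteq> 0"
proof -
  let ?C = "{k. emeasure \<mu> (grid_cell s k) \<noteq> 0}"
  let ?r = "\<lambda>j k. k \<in> grid_nbrs j \<and> k \<in> ?C"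
  have occ: "grid_index s y \<in> ?C" if "y \<in> points \<mu>" for y
    using emeasure_pos_if_point[OF \<mu>, of "grid_cell s (grid_index s y)" y] grid_cell_bounded_borel[OF s(1)] that
    by (auto simp: grid_cell_def bounded_borel_def)
  have chain: "?r\<^sup>*\<^sup>* (grid_index s x) (grid_index s y)" if "(linked \<mu> r)\<^sup>*\<^sup>* x y" for y
    using that
  proof induction
    case (step y z)
    have "dist y z \<le> s" using step(2) s(2) by (simp add: linked_def)
    then have "?r (grid_index s y) (grid_index s z)"
      using grid_index_step[OF s(1)] occ step(2) by (simp add: linked_def)
    with step.IH show ?case by (rule rtranclp.rtrancl_into_rtrancl)
  qed simp
  have "infinite {k. ?r\<^sup>*\<^sup>* (grid_index s x) k}"
  proof
    assume fin: "finite {k. ?r\<^sup>*\<^sup>* (grid_index s x) k}"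
    have sub: "cluster \<mu> r x \<subseteq> (\<Union>k\<in>{k. ?r\<^sup>*\<^sup>* (grid_index s x) k}. grid_cell s k)"
      using chain by (auto simp: cluster_def grid_cell_def)
    have "bounded (grid_cell s k)" for k :: 'a
      using grid_cell_bounded_borel[OF s(1)] by (auto simp: bounded_borel_def)
    with fin have "bounded (\<Union>k\<in>{k. ?r\<^sup>*\<^sup>* (grid_index s x) k}. grid_cell s k)"
      by (intro bounded_UN ballI)
    then show False using x(2) sub bounded_subset by blast
  qed
  then obtain l where "l \<in> walks grid_nbrs (grid_index s x) n" "distinct l" "set l \<subseteq> ?C"
    by (rule infinite_cluster_walk[of grid_nbrs ?r "grid_index s x" ?C n, OF finite_grid_nbrs _ _ _ occ[OF x(1)]])
      auto
  then show ?thesis using that by blast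
qed

text \<open>For each starting cell a percolating cluster needs walks of all lengths
  \<open>n\<close>, while the union bound for length \<open>n\<close> is geometric with ratio below
  1.\<close>

lemma measure_percolates_eq_0:
  fixes \<Phi> :: "'a::euclidean_space measure measure"
  assumes \<Phi>: "point_process \<Phi>" and s: "0 < s" "0 < r" "2 * r \<le> s"
    and bound: "\<And>l :: 'a list. \<And>n. distinct l \<Longrightarrow> length l = Suc n \<Longrightarrow>
      measure \<Phi> {\<mu> \<in> space \<Phi>. \<forall>k\<in>set l. emeasure \<mu> (grid_cell s k) \<noteq> 0} \<le> c * q ^ n"
    and q: "0 \<le> c" "0 \<le> q" "q * real (card (grid_steps :: 'a set)) < 1"
  shows "measure \<Phi> {\<mu> \<in> space \<Phi>. percolates (boolean_model \<mu> r)} = 0"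
proof -
  interpret prob_space \<Phi> using point_processD(1)[OF \<Phi>] .
  let ?A = "\<lambda>l. {\<mu> \<in> space \<Phi>. \<forall>k\<in>set l. emeasure \<mu> (grid_cell s k) \<noteq> 0}"
  let ?N = "card (grid_steps :: 'a set)"
  define F where "F = (\<lambda>k n. \<Union>l\<in>{l \<in> walks grid_nbrs k n. distinct l}. ?A l)"
  have A: "?A l \<in> sets \<Phi>" if "l \<noteq> []" for l
  proof -
    have "?A l = space \<Phi> \<inter> (\<Inter>k\<in>set l. {\<mu> \<in> space \<Phi>. emeasure \<mu> (grid_cell s k) \<noteq> 0})"
      by auto
    also have "\<dots> \<in> sets \<Phi>"
      using that by (intro sets.Int sets.top sets.finite_INT count_event_sets[OF \<Phi>] grid_cell_bounded_borel s) auto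
    finally show ?thesis .
  qed
  have walkA: "?A l \<in> sets \<Phi> \<and> measure \<Phi> (?A l) \<le> c * q ^ n"
    if "l \<in> walks grid_nbrs k n" "distinct l" for l k n
  proof
    have "l \<noteq> []" using length_walks[OF that(1)] by auto
    then show "?A l \<in> sets \<Phi>" by (rule A)
    show "measure \<Phi> (?A l) \<le> c * q ^ n" by (rule bound[OF that(2) length_walks[OF that(1)]])
  qed
  have F_sets: "F k n \<in> sets \<Phi>" for k n
    unfolding F_def using q
    by (intro measure_walks_le(1)[OF finite_measure_axioms finite_grid_nbrs card_grid_nbrs walkA]) auto
  have F_le: "measure \<Phi> (F k n) \<le> c * (q * real ?N) ^ n" for k n
  proof -
    have "measure \<Phi> (F k n) \<le> real ?N ^ n * (c * q ^ n)"
      unfolding F_def using q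
      by (intro measure_walks_le(2)[OF finite_measure_axioms finite_grid_nbrs card_grid_nbrs walkA]) auto
    then show ?thesis by (simp add: power_mult_distrib algebra_simps)
  qed
  have null: "(\<Inter>n. F k n) \<in> null_sets \<Phi>" for k
  proof -
    have "(\<lambda>n. c * (q * real ?N) ^ n) \<longlonglongrightarrow> c * 0"
      using q by (intro tendsto_mult tendsto_const LIMSEQ_power_zero) auto
    moreover have "measure \<Phi> (\<Inter>n. F k n) \<le> c * (q * real ?N) ^ m" for m
    proof -
      have "measure \<Phi> (\<Inter>n. F k n) \<le> measure \<Phi> (F k m)"
        using F_sets by (intro finite_measure_mono) auto
      then show ?thesis using F_le[of k m] by simp
    qed
    ultimately have "measure \<Phi> (\<Inter>n. F k n) \<le> 0"
      by (metis LIMSEQ_le_const mult_zero_right)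
    then have "measure \<Phi> (\<Inter>n. F k n) = 0" using measure_nonneg by (rule antisym)
    then show ?thesis
      using F_sets by (intro null_setsI sets.countable_INT) (auto simp: emeasure_eq_measure)
  qed
  have N: "(\<Union>k\<in>range (grid_index s). \<Inter>n. F k n) \<in> null_sets \<Phi>"
    using null by (intro null_sets_UN' countable_range_grid_index) auto
  have "{\<mu> \<in> space \<Phi>. percolates (boolean_model \<mu> r)} \<subseteq> (\<Union>k\<in>range (grid_index s). \<Inter>n. F k n)"
  proof clarify
    fix \<mu> assume \<mu>: "\<mu> \<in> space \<Phi>" "percolates (boolean_model \<mu> r)"
    have conf: "\<mu> \<in> configurations" using \<mu>(1) point_processD(3)[OF \<Phi>] by simp
    then obtain x where x: "x \<in> points \<mu>" "\<not> bounded (cluster \<mu> r x)"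
      using percolates_iff_unbounded_cluster[OF conf s(2)] \<mu>(2) by blast
    have "\<mu> \<in> F (grid_index s x) n" for n
    proof -
      obtain l where l: "l \<in> walks grid_nbrs (grid_index s x) n" "distinct l"
        "\<And>k. k \<in> set l \<Longrightarrow> emeasure \<mu> (grid_cell s k) \<noteq> 0"
        by (rule unbounded_cluster_grid_walk[OF conf s(1,3) x, of n]) (rule that)
      then show ?thesis unfolding F_def using \<mu>(1) by (intro UN_I[of l]) auto
    qed
    then show "\<mu> \<in> (\<Union>k\<in>range (grid_index s). \<Inter>n. F k n)"
      by (intro UN_I[of "grid_index s x"] INT_I rangeI)
  qed
  \<comment> \<open>Monotonicity asks for measurability of the covering null set only, so the
    percolation event needs no separate treatment here.\<close>
  from emeasure_mono[OF this null_setsD2[OF N]]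
  have "emeasure \<Phi> {\<mu> \<in> space \<Phi>. percolates (boolean_model \<mu> r)} = 0"
    unfolding null_setsD1[OF N] by (rule le_zero_eq[THEN iffD1])
  then show ?thesis by (simp only: measure_def enn2real_0)
qed

section \<open>Probability that given cells are all occupied\<close>

lemma poisson_process_count:
  "poisson_process \<Lambda> \<Psi> \<Longrightarrow> B \<in> bounded_borel \<Longrightarrow> poisson_count \<Psi> B (measure \<Lambda> B)"
  unfolding poisson_process_def poisson_count_def by blast

lemma homogeneous_poisson_process_count:
  assumes "homogeneous_poisson_process lam \<Psi>" "B \<in> bounded_borel" "0 \<le> lam"
  shows "poisson_count \<Psi> B (lam * measure lborel B)"
proof -
  have "measure (scale_measure (ennreal lam) lborel) B = lam * measure lborel B"
    using assms(3) by (simp add: measure_def enn2real_mult)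
  then show ?thesis using assms(1,2) poisson_process_count
    unfolding homogeneous_poisson_process_def by metis
qed

lemma emeasure_lborel_bounded_borel:
  fixes B :: "'a::euclidean_space set"
  assumes "B \<in> bounded_borel"
  shows "emeasure lborel B = ennreal (measure lborel B)"
  using assms emeasure_bounded_finite[of B] by (simp add: bounded_borel_def emeasure_eq_ennreal_measure)

lemma Union_bounded_borel: "finite I \<Longrightarrow> (\<And>i. i \<in> I \<Longrightarrow> f i \<in> bounded_borel) \<Longrightarrow> (\<Union>i\<in>I. f i) \<in> bounded_borel"
  unfolding bounded_borel_def by (auto intro!: bounded_UN)

text \<open>The cells have total volume at most \<open>real (Suc n) * s ^ DIM('a)\<close>, so the
  condition on \<open>s\<close> bounds the exponent \<open>t * (a - 1)\<close> by
  \<open>real (Suc n)\<close>: one factor e per cell.\<close>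

lemma prob_grid_occupied_le_idcx:
  fixes l :: "'a::euclidean_space list"
  assumes \<Phi>: "point_process \<Phi>" and \<Psi>: "point_process \<Psi>"
    and poi: "\<And>B. B \<in> bounded_borel \<Longrightarrow> poisson_count \<Psi> B (lam * measure lborel B)"
    and le: "process_le idcx \<Phi> \<Psi>" and fin: "locally_finite_mean \<Phi>" and lam: "0 < lam"
    and a: "2 \<le> a" and s: "0 < s" "lam * s ^ DIM('a) * (a - 1) \<le> 1"
    and l: "distinct l" "length l = Suc n"
  shows "measure \<Phi> {\<mu> \<in> space \<Phi>. \<forall>k\<in>set l. emeasure \<mu> (grid_cell s k) \<noteq> 0} \<le> exp 1 * (exp 1 / a) ^ n"
proof -
  interpret prob_space \<Phi> using point_processD(1)[OF \<Phi>] .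
  let ?B = "\<Union>k\<in>set l. grid_cell s k"
  have cell: "grid_cell s k \<in> bounded_borel" for k :: 'a by (rule grid_cell_bounded_borel[OF s(1)])
  have B: "?B \<in> bounded_borel" using cell by (intro Union_bounded_borel) auto
  have card: "card (set l) = Suc n" using l by (simp add: distinct_card)
  have disj: "disjoint_family_on (grid_cell s) (set l)"
    using disjoint_grid_cells unfolding disjoint_family_on_def by blast
  have "{\<mu> \<in> space \<Phi>. \<forall>k\<in>set l. emeasure \<mu> (grid_cell s k) \<noteq> 0} \<subseteq>
      {\<mu> \<in> space \<Phi>. of_nat (Suc n) \<le> emeasure \<mu> ?B}"
  proof clarify
    fix \<mu> assume \<mu>: "\<mu> \<in> space \<Phi>" and occ: "\<forall>k\<in>set l. emeasure \<mu> (grid_cell s k) \<noteq> 0"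
    have conf: "\<mu> \<in> configurations" using \<mu> point_processD(3)[OF \<Phi>] by simp
    have "of_nat (Suc n) = (\<Sum>k\<in>set l. 1 :: ennreal)" using card by simp
    also have "\<dots> \<le> (\<Sum>k\<in>set l. emeasure \<mu> (grid_cell s k))"
      using occ by (intro sum_mono configuration_ge_1[OF conf cell]) auto
    also have "\<dots> = emeasure \<mu> ?B"
      using cell disj sets_configuration[OF conf] by (intro sum_emeasure) (auto simp: bounded_borel_def)
    finally show "of_nat (Suc n) \<le> emeasure \<mu> ?B" .
  qed
  then have "measure \<Phi> {\<mu> \<in> space \<Phi>. \<forall>k\<in>set l. emeasure \<mu> (grid_cell s k) \<noteq> 0} \<le>
      measure \<Phi> {\<mu> \<in> space \<Phi>. of_nat (Suc n) \<le> emeasure \<mu> ?B}"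
    using count_event_sets[OF \<Phi> B] by (intro finite_measure_mono)
  also have "\<dots> \<le> exp (lam * measure lborel ?B * (a - 1)) / a ^ n"
    using fin B lam by (intro prob_count_ge_le[OF \<Phi> \<Psi> B poi[OF B] _ a le]) (auto simp: locally_finite_mean_def)
  also have "\<dots> \<le> exp (real (Suc n)) / a ^ n"
  proof -
    have "emeasure lborel ?B \<le> (\<Sum>k\<in>set l. emeasure lborel (grid_cell s k))"
      using cell by (intro emeasure_subadditive_finite) (auto simp: bounded_borel_def)
    also have "\<dots> \<le> (\<Sum>k\<in>set l. ennreal (s ^ DIM('a)))"
      by (intro sum_mono emeasure_grid_cell_le s)
    also have "\<dots> = ennreal (real (Suc n) * s ^ DIM('a))"
      using s(1) card by (simp add: ennreal_of_nat_eq_real_of_nat ennreal_mult[symmetric] del: of_nat_Suc)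
    finally have "measure lborel ?B \<le> real (Suc n) * s ^ DIM('a)"
      using s(1) unfolding emeasure_lborel_bounded_borel[OF B] by (subst (asm) ennreal_le_iff) auto
    then have "lam * measure lborel ?B * (a - 1) \<le> lam * (real (Suc n) * s ^ DIM('a)) * (a - 1)"
      using lam a by (intro mult_right_mono mult_left_mono) auto
    also have "\<dots> = real (Suc n) * (lam * s ^ DIM('a) * (a - 1))" by (simp add: algebra_simps)
    also have "\<dots> \<le> real (Suc n)" using mult_left_mono[OF s(2), of "real (Suc n)"] by simp
    finally show ?thesis using a by (intro divide_right_mono) auto
  qed
  also have "\<dots> = exp 1 * (exp 1 / a) ^ n"
    by (simp add: exp_add power_divide exp_of_nat_mult[of n 1, simplified])
  finally show ?thesis .
qed

text \<open>The bound is put in the same shape as in the idcx case, so that one percolation estimate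
  serves both. The cells are indexed by positions in \<open>l\<close> because
  \<open>joint_intensity\<close> speaks of families over an initial segment.\<close>

lemma prob_grid_occupied_le_weak:
  fixes l :: "'a::euclidean_space list"
  assumes \<Phi>: "point_process \<Phi>" and weak: "weakly_sub_poisson lam \<Phi>" and lam: "0 < lam"
    and a: "2 \<le> a" and s: "0 < s" "lam * s ^ DIM('a) * (a - 1) \<le> 1"
    and l: "distinct l" "length l = Suc n"
  shows "measure \<Phi> {\<mu> \<in> space \<Phi>. \<forall>k\<in>set l. emeasure \<mu> (grid_cell s k) \<noteq> 0} \<le> exp 1 * (exp 1 / a) ^ n"
proof -
  let ?B = "\<lambda>i. grid_cell s (l ! i)"
  let ?v = "s ^ DIM('a)"
  have disj: "disjoint_family_on ?B {..<Suc n}"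
    unfolding disjoint_family_on_def
  proof (intro ballI impI)
    fix i j assume "i \<in> {..<Suc n}" "j \<in> {..<Suc n}" "i \<noteq> j"
    then have "l ! i \<noteq> l ! j" using l by (simp add: nth_eq_iff_index_eq)
    then show "?B i \<inter> ?B j = {}" by (rule disjoint_grid_cells)
  qed
  have "measure \<Phi> {\<mu> \<in> space \<Phi>. \<forall>k\<in>set l. emeasure \<mu> (grid_cell s k) \<noteq> 0} =
      measure \<Phi> {\<mu> \<in> space \<Phi>. \<forall>i<Suc n. emeasure \<mu> (?B i) \<noteq> 0}"
    using l(2) by (intro arg_cong[where f="measure \<Phi>"]) (auto simp: all_set_conv_all_nth)
  also have "\<dots> \<le> (lam * ?v) ^ Suc n"
    using lam s(1)
    by (intro weakly_sub_poisson_occupied_le[OF \<Phi> weak _ grid_cell_bounded_borel[OF s(1)] disj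
          emeasure_grid_cell_le[OF s(1)]]) auto
  also have "\<dots> \<le> (exp 1 / a) ^ Suc n"
  proof (rule power_mono)
    \<comment> \<open>For \<open>2 \<le> a\<close> one has \<open>a \<le> 2 * (a - 1)\<close>, and 2
      is at most e.\<close>
    have "lam * ?v \<le> 1 / (a - 1)" using s(2) a by (simp add: pos_le_divide_eq)
    also have "\<dots> \<le> 2 / a" using a by (simp add: field_simps)
    also have "\<dots> \<le> exp 1 / a" using a exp_ge_add_one_self[of 1] by (intro divide_right_mono) auto
    finally show "lam * ?v \<le> exp 1 / a" .
  qed (use lam s in auto)
  also have "\<dots> \<le> exp 1 * (exp 1 / a) ^ n"
    using a by (simp add: divide_le_eq mult_left_le)
  finally show ?thesis .
qed

section \<open>The upper bound\<close>

text \<open>Full-dimensional cubes over a quadrant of the plane of \<open>b1\<close> and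
  \<open>b2\<close>, since a plane itself may have no volume. Being open they are disjoint; points
  on faces are ignored, which can only make more cells void.\<close>

definition planar_box :: "real \<Rightarrow> 'a \<Rightarrow> 'a \<Rightarrow> nat \<times> nat \<Rightarrow> 'a::euclidean_space set" where
  "planar_box L b1 b2 v = box (L *\<^sub>R (real (fst v) *\<^sub>R b1 + real (snd v) *\<^sub>R b2))
     (L *\<^sub>R (real (fst v) *\<^sub>R b1 + real (snd v) *\<^sub>R b2) + L *\<^sub>R One)"

lemma mem_planar_box:
  assumes "b1 \<in> Basis" "b2 \<in> Basis" "b1 \<noteq> b2" "b \<in> Basis" "x \<in> planar_box L b1 b2 v"
  defines "k \<equiv> (if b = b1 then real (fst v) else if b = b2 then real (snd v) else 0)"
  shows "L * k < x \<bullet> b" "x \<bullet> b < L * k + L"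
proof -
  have "(real (fst v) *\<^sub>R b1 + real (snd v) *\<^sub>R b2) \<bullet> b = k"
    using assms(1-4) by (auto simp: k_def inner_add_left inner_Basis)
  then show "L * k < x \<bullet> b" "x \<bullet> b < L * k + L"
    using assms(4,5) by (auto simp: planar_box_def mem_box inner_add_left inner_scaleR_left)
qed

lemma planar_box_bounded_borel: "planar_box L b1 b2 v \<in> bounded_borel"
  unfolding planar_box_def by (intro bounded_borelI) auto

lemma emeasure_planar_box:
  "0 < L \<Longrightarrow> emeasure lborel (planar_box L b1 b2 v :: 'a::euclidean_space set) = ennreal (L ^ DIM('a))"
  unfolding planar_box_def by (subst emeasure_lborel_box) (auto simp: inner_add_left)

lemma planar_box_disjoint:
  assumes b: "b1 \<in> Basis" "b2 \<in> Basis" "b1 \<noteq> b2" and L: "0 < L" and ne: "u \<noteq> v"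
  shows "planar_box L b1 b2 u \<inter> planar_box L b1 b2 v = {}"
proof (rule ccontr)
  assume "\<not> ?thesis"
  then obtain x where x: "x \<in> planar_box L b1 b2 u" "x \<in> planar_box L b1 b2 v" by blast
  have sep: "m = n" if "L * real m < t" "t < L * real m + L" "L * real n < t" "t < L * real n + L" for m n t
  proof -
    have "L * real m < L * (real n + 1)" "L * real n < L * (real m + 1)"
      using that by (auto simp: algebra_simps)
    then have "real m < real n + 1" "real n < real m + 1" using L by auto
    then show ?thesis by linarith
  qed
  have "fst u = fst v"
    using mem_planar_box[OF b b(1) x(1)] mem_planar_box[OF b b(1) x(2)] by (intro sep) auto
  moreover have "snd u = snd v"
    using mem_planar_box[OF b b(2) x(1)] mem_planar_box[OF b b(2) x(2)] b(3) by (intro sep) auto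
  ultimately show False using ne by (simp add: prod_eq_iff)
qed

text \<open>Each coordinate differs by at most \<open>2 * L\<close>, and the norm is at most the sum
  of the coordinates. This crude bound is the origin of the radius
  \<open>L * DIM('a)\<close>.\<close>

lemma dist_adjacent_planar_boxes:
  fixes x y :: "'a::euclidean_space"
  assumes b: "b1 \<in> Basis" "b2 \<in> Basis" "b1 \<noteq> b2" and L: "0 < L" and adj: "adjacent u v"
    and x: "x \<in> planar_box L b1 b2 u" and y: "y \<in> planar_box L b1 b2 v"
  shows "dist x y \<le> 2 * (L * DIM('a))"
proof -
  have "\<bar>(x - y) \<bullet> b\<bar> \<le> 2 * L" if b': "b \<in> Basis" for b
  proof -
    let ?k = "\<lambda>v. if b = b1 then real (fst v) else if b = b2 then real (snd v) else 0"
    have "\<bar>?k u - ?k v\<bar> \<le> 1" using adj by (auto simp: adjacent_def)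
    then have "L * \<bar>?k u - ?k v\<bar> \<le> L * 1" using L by (intro mult_left_mono) auto
    then have "\<bar>L * ?k u - L * ?k v\<bar> \<le> L" using L by (simp add: right_diff_distrib[symmetric] abs_mult)
    then show ?thesis
      using mem_planar_box[OF b b' x] mem_planar_box[OF b b' y] unfolding inner_diff_left by linarith
  qed
  then have "(\<Sum>b\<in>Basis. \<bar>(x - y) \<bullet> b\<bar>) \<le> (\<Sum>b\<in>(Basis::'a set). 2 * L)" by (rule sum_mono)
  then show ?thesis using norm_le_l1[of "x - y"] by (simp add: dist_norm algebra_simps)
qed

text \<open>Without a void walk the corner has an infinite cluster of occupied cells. One point
  chosen from each of these disjoint cells gives infinitely many linked points, and local finiteness
  makes their cluster unbounded.\<close>

lemma no_void_walk_imp_percolates: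
  fixes \<mu> :: "'a::euclidean_space measure"
  assumes \<mu>: "\<mu> \<in> configurations" and b: "b1 \<in> Basis" "b2 \<in> Basis" "b1 \<noteq> b2" and L: "0 < L"
    and none: "\<And>i l. l \<in> walks star_nbrs (i, 0) i \<Longrightarrow> distinct l \<Longrightarrow> \<exists>v\<in>set l. emeasure \<mu> (planar_box L b1 b2 v) \<noteq> 0"
  shows "percolates (boolean_model \<mu> (L * DIM('a)))"
proof -
  let ?r = "L * DIM('a)"
  have r: "0 < ?r" using L by simp
  let ?C = "{v. emeasure \<mu> (planar_box L b1 b2 v) = 0}"
  let ?R = "\<lambda>u v. adjacent u v \<and> v \<notin> ?C"
  let ?K = "{v. ?R\<^sup>*\<^sup>* (0, 0) v}"
  have inf: "infinite ?K"
  proof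
    assume "finite ?K"
    then obtain i l where "l \<in> walks star_nbrs (i, 0) i" "distinct l" "set l \<subseteq> ?C"
      by (rule finite_cluster_closed_walk)
    then show False using none by blast
  qed
  \<comment> \<open>\<open>?K\<close> contains the corner by reflexivity; that its cell is occupied
    comes from the walk with no steps.\<close>
  have "[(0, 0)] \<in> walks star_nbrs (0, 0) 0" by simp
  from none[OF this] have "(0, 0) \<notin> ?C" by simp
  have "\<exists>x. x \<in> planar_box L b1 b2 v \<and> x \<in> points \<mu>" if "v \<notin> ?C" for v
    using point_in_bounded_borel[OF \<mu> planar_box_bounded_borel] that by blast
  then obtain p where p: "\<And>v. v \<notin> ?C \<Longrightarrow> p v \<in> planar_box L b1 b2 v" "\<And>v. v \<notin> ?C \<Longrightarrow> p v \<in> points \<mu>"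
    by metis
  have reach: "v \<notin> ?C \<and> (linked \<mu> ?r)\<^sup>*\<^sup>* (p (0, 0)) (p v)" if "?R\<^sup>*\<^sup>* (0, 0) v" for v
    using that
  proof induction
    case base show ?case using \<open>(0, 0) \<notin> ?C\<close> by blast
  next
    case (step u v)
    then have uv: "adjacent u v" "u \<notin> ?C" "v \<notin> ?C" by blast+
    then have "linked \<mu> ?r (p u) (p v)"
      using p dist_adjacent_planar_boxes[OF b L uv(1), of "p u" "p v"] by (simp add: linked_def)
    with step.IH uv(3) show ?case by (meson rtranclp.rtrancl_into_rtrancl)
  qed
  have "inj_on p ?K"
  proof (rule inj_onI)
    fix u v assume uv: "u \<in> ?K" "v \<in> ?K" and eq: "p u = p v"
    have "p u \<in> planar_box L b1 b2 u" "p v \<in> planar_box L b1 b2 v" using reach p(1) uv by blast+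
    then show "u = v" using planar_box_disjoint[OF b L, of u v] eq by auto
  qed
  then have "infinite (p ` ?K)" using inf finite_imageD by blast
  moreover have "p ` ?K \<subseteq> cluster \<mu> ?r (p (0, 0))"
    unfolding cluster_def using reach by blast
  ultimately have "infinite (cluster \<mu> ?r (p (0, 0)))" using finite_subset by blast
  moreover have pt: "p (0, 0) \<in> points \<mu>" using p(2) \<open>(0, 0) \<notin> ?C\<close> by blast
  ultimately have "\<not> bounded (cluster \<mu> ?r (p (0, 0)))"
    using finite_points_bounded[OF \<mu>] cluster_points[OF pt] by (metis inf.absorb_iff2)
  then show ?thesis using percolates_iff_unbounded_cluster[OF \<mu> r] pt by blast
qed

text \<open>The number 18 is twice the bound 9 on king moves: a walk with \<open>i\<close> steps has
  \<open>i + 1\<close> cells, so its length contributes at most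
  \<open>(1 / 18) * (1 / 2) ^ i\<close>, and the sum over \<open>i\<close> is
  \<open>1 / 9\<close>.\<close>

lemma measure_percolates_pos:
  fixes \<Phi> :: "'a::euclidean_space measure measure"
  assumes \<Phi>: "point_process \<Phi>" and b: "b1 \<in> Basis" "b2 \<in> Basis" "b1 \<noteq> b2" and L: "0 < L"
    and bound: "\<And>l :: (nat \<times> nat) list. distinct l \<Longrightarrow>
      measure \<Phi> {\<mu> \<in> space \<Phi>. \<forall>v\<in>set l. emeasure \<mu> (planar_box L b1 b2 v) = 0} \<le> (1 / 18) ^ length l"
  shows "0 < measure \<Phi> {\<mu> \<in> space \<Phi>. percolates (boolean_model \<mu> (L * DIM('a)))}"
proof -
  interpret prob_space \<Phi> using point_processD(1)[OF \<Phi>] .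
  let ?A = "\<lambda>l. {\<mu> \<in> space \<Phi>. \<forall>v\<in>set l. emeasure \<mu> (planar_box L b1 b2 v) = 0}"
  let ?P = "{\<mu> \<in> space \<Phi>. percolates (boolean_model \<mu> (L * DIM('a)))}"
  define E where "E = (\<lambda>i. \<Union>l\<in>{l \<in> walks star_nbrs (i, 0) i. distinct l}. ?A l)"
  have A: "?A l \<in> sets \<Phi>" if "l \<noteq> []" for l
  proof -
    have "?A l = space \<Phi> \<inter> (\<Inter>v\<in>set l. {\<mu> \<in> space \<Phi>. emeasure \<mu> (planar_box L b1 b2 v) = 0})"
      by auto
    also have "\<dots> \<in> sets \<Phi>"
      using that by (intro sets.Int sets.top sets.finite_INT count_event_sets[OF \<Phi>] planar_box_bounded_borel) auto
    finally show ?thesis .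
  qed
  have walkA: "?A l \<in> sets \<Phi> \<and> measure \<Phi> (?A l) \<le> (1 / 18) ^ Suc i"
    if "l \<in> walks star_nbrs (i, 0) i" "distinct l" for l i
  proof
    have "l \<noteq> []" using length_walks[OF that(1)] by auto
    then show "?A l \<in> sets \<Phi>" by (rule A)
    show "measure \<Phi> (?A l) \<le> (1 / 18) ^ Suc i"
      using bound[OF that(2)] by (simp only: length_walks[OF that(1)])
  qed
  have E_sets: "E i \<in> sets \<Phi>" for i
    unfolding E_def
    by (rule measure_walks_le(1)[OF finite_measure_axioms finite_star_nbrs card_star_nbrs walkA]) auto
  have E_le: "measure \<Phi> (E i) \<le> (1 / 18) * (1 / 2) ^ i" for i
  proof -
    have "measure \<Phi> (E i) \<le> real 9 ^ i * (1 / 18) ^ Suc i"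
      unfolding E_def
      by (rule measure_walks_le(2)[OF finite_measure_axioms finite_star_nbrs card_star_nbrs walkA]) auto
    also have "\<dots> = (1 / 18) * (9 * (1 / 18)) ^ i" by (simp add: power_mult_distrib[symmetric])
    finally show ?thesis by simp
  qed
  have sums: "(\<lambda>i. (1 / 18) * (1 / 2 :: real) ^ i) sums ((1 / 18) * (1 / (1 - 1 / 2)))"
    by (intro sums_mult geometric_sums) simp
  have summ: "summable (\<lambda>i. measure \<Phi> (E i))"
    by (rule summable_comparison_test'[OF sums_summable[OF sums]]) (use E_le in simp)
  have "measure \<Phi> (\<Union>i. E i) \<le> (\<Sum>i. measure \<Phi> (E i))"
    using E_sets by (intro finite_measure_subadditive_countably summ) auto
  also have "\<dots> \<le> (\<Sum>i. (1 / 18) * (1 / 2 :: real) ^ i)"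
    using E_le by (intro suminf_le summ sums_summable[OF sums])
  also have "\<dots> = 1 / 9" using sums_unique[OF sums] by simp
  finally have "measure \<Phi> (\<Union>i. E i) < 1" by simp
  moreover have "(\<Union>i. E i) \<in> sets \<Phi>" using E_sets by blast
  ultimately have "0 < measure \<Phi> (space \<Phi> - (\<Union>i. E i))" using prob_compl by simp
  also have "\<dots> \<le> measure \<Phi> ?P"
  proof (rule finite_measure_mono)
    show "space \<Phi> - (\<Union>i. E i) \<subseteq> ?P"
    proof
      fix \<mu> assume \<mu>: "\<mu> \<in> space \<Phi> - (\<Union>i. E i)"
      then have "\<exists>v\<in>set l. emeasure \<mu> (planar_box L b1 b2 v) \<noteq> 0"
        if "l \<in> walks star_nbrs (i, 0) i" "distinct l" for i l
        using that unfolding E_def by blast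
      then have "percolates (boolean_model \<mu> (L * DIM('a)))"
        using \<mu> point_processD(3)[OF \<Phi>] by (intro no_void_walk_imp_percolates[OF _ b L]) auto
      then show "\<mu> \<in> ?P" using \<mu> by blast
    qed
    show "?P \<in> sets \<Phi>"
      using percolation_event_measurable[of "L * DIM('a)"] L point_processD[OF \<Phi>] by simp
  qed
  finally show ?thesis .
qed

text \<open>All cells are void only if their union is, so a single void probability is compared. The
  product form arises because the exponential turns additive volume into a power, with no
  independence of the cells.\<close>

lemma prob_planar_void_le:
  fixes l :: "(nat \<times> nat) list" and b1 b2 :: "'a::euclidean_space"
  assumes \<Phi>: "point_process \<Phi>" and \<Psi>: "point_process \<Psi>"
    and poi: "\<And>B. B \<in> bounded_borel \<Longrightarrow> poisson_count \<Psi> B (lam * measure lborel B)"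
    and le: "process_le ddcx \<Phi> \<Psi>"
    and b: "b1 \<in> Basis" "b2 \<in> Basis" "b1 \<noteq> b2" and L: "0 < L" "exp (- (lam * L ^ DIM('a))) \<le> \<epsilon>"
    and l: "distinct l"
  shows "measure \<Phi> {\<mu> \<in> space \<Phi>. \<forall>v\<in>set l. emeasure \<mu> (planar_box L b1 b2 v) = 0} \<le> \<epsilon> ^ length l"
proof -
  interpret prob_space \<Phi> using point_processD(1)[OF \<Phi>] .
  let ?B = "\<Union>v\<in>set l. planar_box L b1 b2 v"
  have box: "planar_box L b1 b2 v \<in> bounded_borel" for v by (rule planar_box_bounded_borel)
  have B: "?B \<in> bounded_borel" using box by (intro Union_bounded_borel) auto
  have "{\<mu> \<in> space \<Phi>. \<forall>v\<in>set l. emeasure \<mu> (planar_box L b1 b2 v) = 0} \<subseteq> {\<mu> \<in> space \<Phi>. emeasure \<mu> ?B = 0}"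
  proof clarify
    fix \<mu> assume \<mu>: "\<mu> \<in> space \<Phi>" and void: "\<forall>v\<in>set l. emeasure \<mu> (planar_box L b1 b2 v) = 0"
    have "sets \<mu> = sets borel" using \<mu> point_processD(3)[OF \<Phi>] sets_configuration by blast
    then have "emeasure \<mu> ?B \<le> (\<Sum>v\<in>set l. emeasure \<mu> (planar_box L b1 b2 v))"
      using box by (intro emeasure_subadditive_finite) (auto simp: bounded_borel_def)
    then show "emeasure \<mu> ?B = 0" using void by simp
  qed
  then have "measure \<Phi> {\<mu> \<in> space \<Phi>. \<forall>v\<in>set l. emeasure \<mu> (planar_box L b1 b2 v) = 0} \<le>
      measure \<Phi> {\<mu> \<in> space \<Phi>. emeasure \<mu> ?B = 0}"
    using count_event_sets[OF \<Phi> B] by (intro finite_measure_mono)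
  also have "\<dots> \<le> exp (- (lam * measure lborel ?B))"
    by (rule prob_void_le[OF \<Phi> \<Psi> B poi[OF B] le])
  also have "measure lborel ?B = real (length l) * L ^ DIM('a)"
  proof -
    have "emeasure lborel ?B = (\<Sum>v\<in>set l. emeasure lborel (planar_box L b1 b2 v))"
      using box planar_box_disjoint[OF b L(1)]
      by (intro sum_emeasure[symmetric]) (auto simp: bounded_borel_def disjoint_family_on_def)
    also have "\<dots> = ennreal (real (length l) * L ^ DIM('a))"
      using L(1) l by (simp add: emeasure_planar_box distinct_card ennreal_of_nat_eq_real_of_nat ennreal_mult)
    finally show ?thesis using L(1) by (simp add: measure_def)
  qed
  also have "exp (- (lam * (real (length l) * L ^ DIM('a)))) = exp (- (lam * L ^ DIM('a))) ^ length l"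
    by (simp add: exp_of_nat_mult[symmetric] algebra_simps)
  also have "\<dots> \<le> \<epsilon> ^ length l" using L(2) by (intro power_mono) auto
  finally show ?thesis .
qed

section \<open>The critical radius\<close>

lemma critical_radius_geI:
  assumes "\<And>r. 0 < r \<Longrightarrow> r < c \<Longrightarrow> measure \<Phi> {\<mu> \<in> space \<Phi>. percolates (boolean_model \<mu> r)} = 0"
  shows "ereal c \<le> critical_radius \<Phi>"
  unfolding critical_radius_def
proof (rule INF_greatest)
  fix r assume "r \<in> {r. 0 < r \<and> measure \<Phi> {\<mu> \<in> space \<Phi>. percolates (boolean_model \<mu> r)} > 0}"
  then show "ereal c \<le> ereal r" using assms[of r] by fastforce
qed

lemma critical_radius_leI:
  "0 < r \<Longrightarrow> 0 < measure \<Phi> {\<mu> \<in> space \<Phi>. percolates (boolean_model \<mu> r)} \<Longrightarrow> critical_radius \<Phi> \<le> ereal r"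
  unfolding critical_radius_def by (rule INF_lower) simp

lemma process_le_mono: "process_le F \<Phi> \<Psi> \<Longrightarrow> (\<And>n. G n \<subseteq> F n) \<Longrightarrow> process_le G \<Phi> \<Psi>"
  unfolding process_le_def vector_le_def by blast

lemma exists_two_Basis:
  assumes "2 \<le> DIM('a)"
  obtains b1 b2 :: "'a::euclidean_space" where "b1 \<in> Basis" "b2 \<in> Basis" "b1 \<noteq> b2"
proof -
  obtain S where "S \<subseteq> (Basis :: 'a set)" "card S = 2"
    using assms by (metis obtain_subset_with_card_n)
  then show ?thesis using that unfolding card_2_iff by blast
qed

text \<open>On the line the Boolean model of a homogeneous Poisson process almost surely has gaps at
  every radius and does not percolate; hence the dimension condition on the upper bounds.\<close>

theorem mainTheorem1:
  fixes lam :: real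
  assumes "0 < lam"
  shows "\<exists>c C :: real. 0 < c \<and>
    (\<forall>\<Phi> :: 'a::euclidean_space measure measure. point_process \<Phi> \<longrightarrow>
       (\<forall>\<Psi>. homogeneous_poisson_process lam \<Psi> \<and> process_le idcx \<Phi> \<Psi> \<and> locally_finite_mean \<Phi> \<longrightarrow>
          ereal c \<le> critical_radius \<Phi>) \<and>
       (\<forall>\<Psi>. homogeneous_poisson_process lam \<Psi> \<and> process_le ddcx \<Phi> \<Psi> \<and> 2 \<le> DIM('a) \<longrightarrow>
          critical_radius \<Phi> \<le> ereal C) \<and>
       (homogeneous lam \<Phi> \<and> dcx_sub_poisson \<Phi> \<longrightarrow>
          ereal c \<le> critical_radius \<Phi> \<and> (2 \<le> DIM('a) \<longrightarrow> critical_radius \<Phi> \<le> ereal C)) \<and>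
       (weakly_sub_poisson lam \<Phi> \<longrightarrow> ereal c \<le> critical_radius \<Phi>))"
proof -
  note lam = \<open>0 < lam\<close>
  \<comment> \<open>Twice e times more than the branching number makes the ratio in \<open>q\<close>
    less than \<open>1 / 2\<close>; \<open>Suc\<close> gives \<open>2 \<le> a\<close> without
    computing the cardinality.\<close>
  define a where "a = 2 * exp 1 * real (Suc (card (grid_steps :: 'a set)))"
  \<comment> \<open>Capping at 1 gives \<open>s ^ DIM('a) \<le> s\<close>, so a condition linear in
    \<open>s\<close> suffices in every dimension.\<close>
  define s where "s = min 1 (1 / (lam * a))"
  \<comment> \<open>Likewise \<open>1 \<le> L\<close> gives \<open>L \<le> L ^ DIM('a)\<close>,
    hence \<open>18 \<le> lam * L ^ DIM('a)\<close>; then \<open>exp x \<ge> 1 + x\<close> yields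
    the void bound \<open>1 / 18\<close>.\<close>
  define L where "L = max 1 (18 / lam)"
  have a: "2 \<le> a"
  proof -
    have "2 * 1 * 1 \<le> 2 * exp 1 * real (Suc (card (grid_steps :: 'a set)))"
      by (intro mult_mono) auto
    then show ?thesis by (simp add: a_def)
  qed
  have s: "0 < s" "lam * s ^ DIM('a) * (a - 1) \<le> 1"
  proof -
    show "0 < s" using lam a by (simp add: s_def)
    have "s ^ DIM('a) \<le> s"
      using \<open>0 < s\<close> power_decreasing[of 1 "DIM('a)" s] by (simp add: s_def Suc_leI)
    also have "\<dots> \<le> 1 / (lam * a)" by (simp add: s_def)
    finally have "lam * s ^ DIM('a) * (a - 1) \<le> lam * (1 / (lam * a)) * (a - 1)"
      using lam a by (intro mult_right_mono mult_left_mono) auto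
    also have "\<dots> \<le> 1" using lam a by (simp add: field_simps)
    finally show "lam * s ^ DIM('a) * (a - 1) \<le> 1" .
  qed
  have L: "0 < L" "exp (- (lam * L ^ DIM('a))) \<le> 1 / 18"
  proof -
    show "0 < L" by (simp add: L_def)
    have "L \<le> L ^ DIM('a)"
      using power_increasing[of 1 "DIM('a)" L] by (simp add: L_def Suc_leI)
    then have "18 / lam \<le> L ^ DIM('a)" unfolding L_def by linarith
    then have "18 \<le> lam * L ^ DIM('a)" using lam by (simp add: field_simps)
    then have "18 \<le> exp (lam * L ^ DIM('a))" using exp_ge_add_one_self[of "lam * L ^ DIM('a)"] by linarith
    then show "exp (- (lam * L ^ DIM('a))) \<le> 1 / 18" by (simp add: exp_minus field_simps)
  qed
  have q: "exp 1 / a * real (card (grid_steps :: 'a set)) < 1"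
  proof -
    have eq: "exp 1 / a = 1 / (2 * real (Suc (card (grid_steps :: 'a set))))" by (simp add: a_def)
    show ?thesis unfolding eq by (simp add: divide_simps)
  qed
  \<comment> \<open>The constant \<open>s / 2\<close> is the threshold for
    \<open>2 * r \<le> s\<close>, under which linked points lie in equal or neighbouring
    cells.\<close>
  have lower: "ereal (s / 2) \<le> critical_radius \<Phi>"
    if \<Phi>: "point_process \<Phi>" and bound: "\<And>l :: 'a list. \<And>n. distinct l \<Longrightarrow> length l = Suc n \<Longrightarrow>
      measure \<Phi> {\<mu> \<in> space \<Phi>. \<forall>k\<in>set l. emeasure \<mu> (grid_cell s k) \<noteq> 0} \<le> exp 1 * (exp 1 / a) ^ n"
    for \<Phi> :: "'a measure measure"
  proof (rule critical_radius_geI)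
    fix r assume "0 < r" "r < s / 2"
    then show "measure \<Phi> {\<mu> \<in> space \<Phi>. percolates (boolean_model \<mu> r)} = 0"
      using a q by (intro measure_percolates_eq_0[OF \<Phi> s(1) _ _ bound]) auto
  qed
  have lower_idcx: "ereal (s / 2) \<le> critical_radius \<Phi>"
    if "point_process \<Phi>" "point_process \<Psi>"
      "\<And>B. B \<in> bounded_borel \<Longrightarrow> poisson_count \<Psi> B (lam * measure lborel B)"
      "process_le idcx \<Phi> \<Psi>" "locally_finite_mean \<Phi>" for \<Phi> \<Psi> :: "'a measure measure"
    using prob_grid_occupied_le_idcx[OF that lam a s] by (intro lower that(1))
  have upper: "critical_radius \<Phi> \<le> ereal (L * DIM('a))"
    if \<Phi>: "point_process \<Phi>" and \<Psi>: "point_process \<Psi>"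
      and poi: "\<And>B. B \<in> bounded_borel \<Longrightarrow> poisson_count \<Psi> B (lam * measure lborel B)"
      and le: "process_le ddcx \<Phi> \<Psi>" and dim: "2 \<le> DIM('a)" for \<Phi> \<Psi> :: "'a measure measure"
  proof -
    obtain b1 b2 :: 'a where b: "b1 \<in> Basis" "b2 \<in> Basis" "b1 \<noteq> b2"
      using exists_two_Basis[OF dim] .
    show ?thesis
      using L(1) by (intro critical_radius_leI measure_percolates_pos[OF \<Phi> b L(1)]
          prob_planar_void_le[OF \<Phi> \<Psi> poi le b L]) auto
  qed
  have hom: "point_process \<Psi>" "B \<in> bounded_borel \<Longrightarrow> poisson_count \<Psi> B (lam * measure lborel B)"
    if "homogeneous_poisson_process lam \<Psi>" for \<Psi> :: "'a measure measure" and B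
    using that homogeneous_poisson_process_count[OF that _ less_imp_le[OF lam]]
    by (auto simp: homogeneous_poisson_process_def poisson_process_def)
  have sub: "ereal (s / 2) \<le> critical_radius \<Phi> \<and> (2 \<le> DIM('a) \<longrightarrow> critical_radius \<Phi> \<le> ereal (L * DIM('a)))"
    if \<Phi>: "point_process \<Phi>" and homog: "homogeneous lam \<Phi>" and subp: "dcx_sub_poisson \<Phi>"
    for \<Phi> :: "'a measure measure"
  proof -
    obtain \<Lambda> \<Psi> where \<Psi>: "poisson_process \<Lambda> \<Psi>" and le: "process_le dcx \<Phi> \<Psi>"
      using subp unfolding dcx_sub_poisson_def by blast
    have pp: "point_process \<Psi>" using \<Psi> by (simp add: poisson_process_def)
    have mean: "mean_measure \<Phi> B = ennreal (lam * measure lborel B)" if B: "B \<in> bounded_borel" for B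
      using homog B lam emeasure_lborel_bounded_borel[OF B]
      by (simp add: homogeneous_def ennreal_mult)
    have poi: "poisson_count \<Psi> B (lam * measure lborel B)" if B: "B \<in> bounded_borel" for B
    proof -
      \<comment> \<open>The dominating Poisson process is not given as homogeneous; equality of
        means identifies its parameter on every bounded Borel set.\<close>
      have "measure \<Lambda> B = lam * measure lborel B"
        using sub_poisson_mean_eq[OF \<Phi> pp B poisson_process_count[OF \<Psi> B] _ le mean[OF B]] lam by simp
      then show ?thesis using poisson_process_count[OF \<Psi> B] by simp
    qed
    have fin: "locally_finite_mean \<Phi>" using mean by (simp add: locally_finite_mean_def)
    have "process_le idcx \<Phi> \<Psi>" "process_le ddcx \<Phi> \<Psi>"
      by (rule process_le_mono[OF le]; auto simp: idcx_def ddcx_def)+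
    then show ?thesis using lower_idcx[OF \<Phi> pp poi _ fin] upper[OF \<Phi> pp poi] by blast
  qed
  have weak: "ereal (s / 2) \<le> critical_radius \<Phi>"
    if "point_process \<Phi>" "weakly_sub_poisson lam \<Phi>" for \<Phi> :: "'a measure measure"
    using prob_grid_occupied_le_weak[OF that lam a s] by (intro lower that(1))
  show ?thesis
    using s(1) lower_idcx upper hom sub weak
    by (intro exI[of _ "s / 2"] exI[of _ "L * DIM('a)"] conjI allI impI; (elim conjE)?; (simp; fail | blast))
qed

end
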